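(* Let $C_0:\mathbb{R}^d\to\mathbb{C}$ be such that $C(x,y)=C_0(x-y)$, $x,y\in\mathbb{R}^d$, defines a continuous complex covariance function $C:\mathbb{R}^d\times\mathbb{R}^d\to\mathbb{C}$, and suppose $C_0\in L^2(\mathbb{R}^d)$. Let $\varphi=\mathcal{F}(C_0)$ be the spectral density of $C_0$. Then the following two conditions are equivalent: (1) for every compact $S\subset\mathbb{R}^d$, all eigenvalues $\lambda_k^S$ of $C$ restricted to $S\times S$ satisfy $\lambda_k^S\le 1$; (2) $\varphi\le 1$.
   Context: A complex covariance function is a function $C:\mathbb{R}^d\times\mathbb{R}^d\to\mathbb{C}$ that is Hermitian, $C(x,y)=\overline{C(y,x)}$, and non-negative definite. For compact $S\subset\mathbb{R}^d$, $L^2(S)$ is the space of square-integrable functions $h:S\to\mathbb{C}$. The eigenvalues $\lambda_k^S$, $k=1,2,\ldots$, of a continuous complex covariance function $C$ restricted to $S\times S$ are those in its Mercer representation $C(x,y)=\sum_{k=1}^\infty\lambda_k^S\phi_k(x)\overline{\phi_k(y)}$, $(x,y)\in S\times S$ (absolutely and uniformly convergent), where $\{\phi_k\}$ is an orthonormal basis of $L^2(S)$. Equivalently, they are the eigenvalues of the integral operator $h\mapsto\int_S C(\cdot,y)h(y)\,\mathrm{d}y$ on $L^2(S)$. The Fourier transform is $\mathcal{F}(h)(x)=\int h(y)e^{-2\pi\mathrm{i}x\cdot y}\,\mathrm{d}y$ for $h\in L^1(\mathbb{R}^d)\cap L^2(\mathbb{R}^d)$, extended by continuity to a unitary operator on $L^2(\mathbb{R}^d)$.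 Since $C_0$ is continuous and in $L^2(\mathbb{R}^d)$, $\varphi=\mathcal{F}(C_0)$ is the spectral density of $C_0$; it is non-negative and belongs to $L^1(\mathbb{R}^d)\cap L^2(\mathbb{R}^d)$. As an element of $L^2(\mathbb{R}^d)$ it is defined up to Lebesgue null sets, and the inequality $\varphi\le1$ is understood almost everywhere. *)

theory Defs
  imports "HOL-Analysis.Analysis" "HOL-Library.Complex_Order"
begin

text \<open>
  For complex numbers, \<open>z \<le> w\<close> is the order of \<open>HOL-Library.Complex_Order\<close>:
  \<open>Re z \<le> Re w\<close> and \<open>Im z = Im w\<close>. In particular \<open>0 \<le> z\<close> and \<open>z \<le> 1\<close> both include that
  \<open>z\<close> is real.
\<close>

definition hermitian_kernel :: "('a \<Rightarrow> 'a \<Rightarrow> complex) \<Rightarrow> bool" where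
  "hermitian_kernel C \<longleftrightarrow> (\<forall>x y. C x y = cnj (C y x))"

definition nonneg_definite_kernel :: "('a \<Rightarrow> 'a \<Rightarrow> complex) \<Rightarrow> bool" where
  "nonneg_definite_kernel C \<longleftrightarrow>
     (\<forall>(n::nat) (x :: nat \<Rightarrow> 'a) (c :: nat \<Rightarrow> complex).
        0 \<le> (\<Sum>i<n. \<Sum>j<n. c i * cnj (c j) * C (x i) (x j)))"

definition complex_covariance_function :: "('a \<Rightarrow> 'a \<Rightarrow> complex) \<Rightarrow> bool" where
  "complex_covariance_function C \<longleftrightarrow> hermitian_kernel C \<and> nonneg_definite_kernel C"

text \<open>
  The elements of \<open>L1 M\<close> and \<open>L2 M\<close> are functions rather than classes of functions, so
  equality in these spaces is equality almost everywhere. The space \<open>L\<^sup>2(S)\<close> is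
  \<open>L2 (restrict_space lborel S)\<close>, where the values of the functions outside \<open>S\<close> are irrelevant.
  Using \<open>lborel\<close> instead of its completion \<open>lebesgue\<close> does not change these spaces, because
  every Lebesgue measurable function has a Borel measurable representative.
\<close>

definition L1 :: "'a measure \<Rightarrow> ('a \<Rightarrow> complex) set" where
  "L1 M = {f. integrable M f}"

definition L2 :: "'a measure \<Rightarrow> ('a \<Rightarrow> complex) set" where
  "L2 M = {f \<in> borel_measurable M. integrable M (\<lambda>x. (cmod (f x))\<^sup>2)}"

definition L2_dist :: "'a measure \<Rightarrow> ('a \<Rightarrow> complex) \<Rightarrow> ('a \<Rightarrow> complex) \<Rightarrow> real" where
  "L2_dist M f g = sqrt (\<integral>x. (cmod (f x - g x))\<^sup>2 \<partial>M)"

definition integral_operator ::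
  "'a measure \<Rightarrow> ('a \<Rightarrow> 'a \<Rightarrow> complex) \<Rightarrow> ('a \<Rightarrow> complex) \<Rightarrow> 'a \<Rightarrow> complex" where
  "integral_operator M C h = (\<lambda>x. \<integral>y. C x y * h y \<partial>M)"

definition kernel_eigenvalues ::
  "('a::euclidean_space \<Rightarrow> 'a \<Rightarrow> complex) \<Rightarrow> 'a set \<Rightarrow> complex set" where
  "kernel_eigenvalues C S =
     (let M = restrict_space lborel S in
        {l. \<exists>h \<in> L2 M. \<not> (AE x in M. h x = 0) \<and>
              (AE x in M. integral_operator M C h x = l * h x)})"

definition fourier_L1 :: "('a::euclidean_space \<Rightarrow> complex) \<Rightarrow> 'a \<Rightarrow> complex" where
  "fourier_L1 h = (\<lambda>x. \<integral>y. h y * exp (- 2 * complex_of_real pi * \<i> * complex_of_real (x \<bullet> y)) \<partial>lborel)"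

text \<open>
  The relation \<open>has_fourier_L2 f g\<close> is the closure in \<open>L\<^sup>2 \<times> L\<^sup>2\<close> of the graph of \<open>fourier_L1\<close> on
  \<open>L\<^sup>1 \<inter> L\<^sup>2\<close>. By Plancherel's theorem, \<open>fourier_L1\<close> maps \<open>L\<^sup>1 \<inter> L\<^sup>2\<close> isometrically into \<open>L\<^sup>2\<close>, and
  \<open>L\<^sup>1 \<inter> L\<^sup>2\<close> is dense in \<open>L\<^sup>2\<close>; hence for every \<open>f\<close> in \<open>L\<^sup>2\<close> such a \<open>g\<close> exists and is unique up to
  null sets. The function \<open>fourier_L2\<close> picks one representative.
\<close>

definition has_fourier_L2 ::
  "('a::euclidean_space \<Rightarrow> complex) \<Rightarrow> ('a \<Rightarrow> complex) \<Rightarrow> bool" where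
  "has_fourier_L2 f g \<longleftrightarrow> f \<in> L2 lborel \<and> g \<in> L2 lborel \<and>
     (\<exists>h :: nat \<Rightarrow> 'a \<Rightarrow> complex.
        (\<forall>n. h n \<in> L1 lborel \<inter> L2 lborel) \<and>
        (\<lambda>n. L2_dist lborel (h n) f) \<longlonglongrightarrow> 0 \<and>
        (\<lambda>n. L2_dist lborel (fourier_L1 (h n)) g) \<longlonglongrightarrow> 0)"

definition fourier_L2 :: "('a::euclidean_space \<Rightarrow> complex) \<Rightarrow> 'a \<Rightarrow> complex" where
  "fourier_L2 f = (SOME g. has_fourier_L2 f g)"

end

theory Submission
  imports Defs "HOL-Probability.Characteristic_Functions" "HOL-Complex_Analysis.Great_Picard"
begin

text \<open>
  Both conditions say that the quadratic form
  \<open>q(h) = \<integral>\<integral> C0 (x - y) h(y) cnj (h x) dy dx\<close> is bounded by \<open>\<integral> |h|\<^sup>2\<close> on continuous, bounded,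
  integrable functions \<open>h\<close> (\<open>test_function\<close>).

  On the Fourier side, \<open>q(h) = \<integral> \<phi> |Fh|\<^sup>2\<close> (\<open>quadratic_form_spectral\<close>). This is the
  multiplication formula for the Fourier transform together with Fourier inversion for the
  autocorrelation of \<open>h\<close>, whose transform is \<open>|Fh|\<^sup>2\<close>. If \<open>\<phi> \<le> 1\<close> almost everywhere, Bessel's
  inequality \<open>\<integral> |Fh|\<^sup>2 \<le> \<integral> |h|\<^sup>2\<close> bounds the form. Conversely, let \<open>h\<close> be a Gaussian wave packet,
  so that \<open>|Fh|\<^sup>2\<close> is a Gaussian of arbitrary centre and width. The bound on \<open>q\<close> then says that
  all Gaussian averages of \<open>\<phi>\<close> are at most 1, and narrowing the Gaussians gives \<open>\<phi> \<le> 1\<close> almost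
  everywhere (\<open>spectral_density_le_1_iff\<close>). The order on complex numbers carries the
  information that \<open>\<phi>\<close> is real: the averages of \<open>Im \<phi>\<close> vanish because \<open>q\<close> is real.

  On the operator side, suppose that \<open>q(h) > \<integral> |h|\<^sup>2\<close> for some \<open>h\<close> supported in a compact set \<open>S\<close>.
  Let \<open>m > 1\<close> be the supremum of \<open>q\<close> over the unit sphere of \<open>L\<^sup>2(S)\<close>. A maximising sequence \<open>f\<^sub>n\<close>
  satisfies \<open>m f\<^sub>n - T f\<^sub>n \<longlonglongrightarrow> 0\<close>, and the functions \<open>T f\<^sub>n\<close> are equicontinuous, so that by
  Arzela-Ascoli a subsequence converges uniformly. Its limit is an eigenfunction with eigenvalue
  \<open>m\<close> (\<open>exists_eigenvalue_gt_1\<close>). Truncating a test function to large balls therefore shows that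
  \<open>q\<close> is bounded if all eigenvalues are at most 1. Conversely, if \<open>T h = l h\<close> on \<open>S\<close> and
  \<open>l \<noteq> 0\<close>, then \<open>h\<close> agrees almost everywhere on \<open>S\<close> with the continuous function
  \<open>k = T h / l\<close>. Multiplying \<open>k\<close> by continuous cutoffs that decrease to the indicator of \<open>S\<close>
  gives test functions, and in the limit \<open>l \<integral> |k|\<^sup>2 \<le> \<integral> |k|\<^sup>2\<close> over \<open>S\<close>.
\<close>

section \<open>Affine changes of variables\<close>

lemma nn_integral_lborel_affine:
  fixes t :: "'a::euclidean_space"
  assumes [measurable]: "f \<in> borel_measurable borel" and c: "c \<noteq> 0"
  shows "(\<integral>\<^sup>+x. f x \<partial>lborel) = ennreal (\<bar>c\<bar> ^ DIM('a)) * (\<integral>\<^sup>+x. f (t + c *\<^sub>R x) \<partial>lborel)"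
  by (subst lborel_affine[OF c, of t])
     (simp add: nn_integral_density nn_integral_distr nn_integral_cmult)

lemma integrable_lborel_affine:
  fixes t :: "'a::euclidean_space" and f :: "'a \<Rightarrow> 'b :: {banach, second_countable_topology}"
  assumes f: "integrable lborel f" and c: "c \<noteq> 0"
  shows "integrable lborel (\<lambda>x. f (t + c *\<^sub>R x))"
  using f f[THEN borel_measurable_integrable] c unfolding integrable_iff_bounded
  by (subst (asm) nn_integral_lborel_affine[where c=c and t=t]) (auto simp: ennreal_mult_less_top)

lemma integrable_lborel_affine_iff:
  fixes t :: "'a::euclidean_space" and f :: "'a \<Rightarrow> 'b :: {banach, second_countable_topology}"
  assumes c: "c \<noteq> 0"
  shows "integrable lborel (\<lambda>x. f (t + c *\<^sub>R x)) \<longleftrightarrow> integrable lborel f"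
  using
    integrable_lborel_affine[of f c t]
    integrable_lborel_affine[of "\<lambda>x. f (t + c *\<^sub>R x)" "1/c" "- (1/c) *\<^sub>R t"] c
  by (auto simp: algebra_simps)

lemma integral_lborel_affine:
  fixes t :: "'a::euclidean_space" and f :: "'a \<Rightarrow> 'b :: {banach, second_countable_topology}"
  assumes c: "c \<noteq> 0"
  shows "(\<integral>x. f x \<partial>lborel) = (\<bar>c\<bar> ^ DIM('a)) *\<^sub>R (\<integral>x. f (t + c *\<^sub>R x) \<partial>lborel)"
proof cases
  assume f[measurable]: "integrable lborel f"
  then show ?thesis using c f f[THEN borel_measurable_integrable] 
    by (subst lborel_affine[OF c, of t])
       (simp add: integral_density integral_distr)
next
  assume "\<not> integrable lborel f" with c show ?thesis
    using integrable_lborel_affine_iff[OF c, of f t] by (simp add: not_integrable_integral_eq)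
qed

lemma
  fixes t :: "'a::euclidean_space" and f :: "'a \<Rightarrow> 'b :: {banach, second_countable_topology}"
  shows integral_lborel_shift: "(\<integral>x. f (x + t) \<partial>lborel) = (\<integral>x. f x \<partial>lborel)"
    and integral_lborel_reflect: "(\<integral>x. f (t - x) \<partial>lborel) = (\<integral>x. f x \<partial>lborel)"
    and integrable_lborel_shift: "integrable lborel (\<lambda>x. f (x + t)) \<longleftrightarrow> integrable lborel f"
    and integrable_lborel_reflect: "integrable lborel (\<lambda>x. f (t - x)) \<longleftrightarrow> integrable lborel f"
  using integral_lborel_affine[of 1 f t] integral_lborel_affine[of "-1" f t]
    integrable_lborel_affine_iff[of 1 f t] integrable_lborel_affine_iff[of "-1" f t]
  by (simp_all add: add.commute)

section \<open>Plane waves and the Gaussian\<close>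

definition wave :: "'a::euclidean_space \<Rightarrow> 'a \<Rightarrow> complex" where
  "wave x y = cis (- 2 * pi * (x \<bullet> y))"

lemma fourier_L1_wave: "fourier_L1 h x = (\<integral>y. h y * wave x y \<partial>lborel)"
  unfolding fourier_L1_def wave_def cis_conv_exp
  by (simp add: mult_ac)

lemma norm_wave [simp]: "cmod (wave x y) = 1"
  by (simp add: wave_def)

lemma wave_commute: "wave x y = wave y x"
  by (simp add: wave_def inner_commute)

lemma wave_add: "wave x (y + z) = wave x y * wave x z"
  by (simp add: wave_def cis_mult inner_simps algebra_simps)

lemma wave_diff: "wave x (y - z) = wave x y * cnj (wave x z)"
  by (simp add: wave_def cis_mult inner_simps algebra_simps cis_cnj)

lemma wave_measurable [measurable (raw)]:
  assumes "f \<in> borel_measurable M" "g \<in> borel_measurable M"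
  shows "(\<lambda>x. wave (f x) (g x)) \<in> borel_measurable M"
  using assms unfolding wave_def cis_conv_exp by measurable

lemma continuous_on_wave [continuous_intros]:
  "continuous_on A f \<Longrightarrow> continuous_on A g \<Longrightarrow> continuous_on A (\<lambda>x. wave (f x) (g x))"
  unfolding wave_def cis_conv_exp by (intro continuous_intros)

lemma integrable_mult_wave:
  assumes "integrable lborel h"
  shows "integrable lborel (\<lambda>y. h y * wave x y)"
proof (rule Bochner_Integration.integrable_bound[OF assms])
  show "(\<lambda>y. h y * wave x y) \<in> borel_measurable lborel"
    using borel_measurable_integrable[OF assms] by measurable
qed (simp add: norm_mult)

lemma cnj_measurable [measurable (raw)]:
  "f \<in> borel_measurable M \<Longrightarrow> (\<lambda>x. cnj (f x)) \<in> borel_measurable M"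
  by (rule borel_measurable_continuous_on[OF linear_continuous_on[OF bounded_linear_cnj]])

text \<open>
  The factor \<open>\<pi>\<close> makes the Gaussian a fixed point of the Fourier transform and its integral 1.
\<close>

definition gauss :: "'a::euclidean_space \<Rightarrow> real" where
  "gauss x = exp (- pi * (norm x)\<^sup>2)"

lemma gauss_pos [simp]: "gauss x > 0" and gauss_nonneg [simp]: "gauss x \<ge> 0"
  and gauss_le_1 [simp]: "gauss x \<le> 1" and gauss_0 [simp]: "gauss 0 = 1"
  by (simp_all add: gauss_def)

lemma continuous_on_gauss [continuous_intros]:
  "continuous_on A f \<Longrightarrow> continuous_on A (\<lambda>x. gauss (f x))"
  unfolding gauss_def by (intro continuous_intros)

lemma gauss_measurable [measurable]: "gauss \<in> borel_measurable borel"
  by (intro borel_measurable_continuous_onI continuous_intros)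

lemma tendsto_gauss_scaled:
  fixes x :: "'a::euclidean_space"
  assumes "s \<longlonglongrightarrow> 0"
  shows "(\<lambda>n. gauss (s n *\<^sub>R x)) \<longlonglongrightarrow> 1"
proof -
  have c: "continuous_on UNIV (\<lambda>r. gauss (r *\<^sub>R x))" by (intro continuous_intros)
  show ?thesis using continuous_on_tendsto_compose[OF c assms] by simp
qed

lemma gauss_square: "(gauss x)\<^sup>2 = gauss (sqrt 2 *\<^sub>R x)"
  by (simp add: gauss_def power_mult_distrib flip: exp_double)

text \<open>
  In one dimension this is the characteristic function of the standard normal distribution,
  rescaled by \<open>1 / sqrt (2 \<pi>)\<close>.
\<close>

lemma gauss_real_fourier:
  "integrable lborel (\<lambda>x::real. gauss x)"
  "(\<integral>y. complex_of_real (gauss (y::real)) * wave x y \<partial>lborel) = gauss x"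
proof -
  define c where "c = 1 / sqrt (2 * pi)"
  have c: "c \<noteq> 0" "\<bar>c\<bar> = c" "c > 0" by (simp_all add: c_def)
  have g: "gauss (0 + c *\<^sub>R y) = sqrt (2 * pi) * std_normal_density y" for y :: real
    by (simp add: gauss_def normal_density_def c_def power_mult_distrib power_divide)
  have "2 * pi * c = sqrt (2 * pi)"
    unfolding c_def using real_div_sqrt[of "2 * pi"] by simp
  then have c2: "- 2 * pi * (x * (c * y)) = - sqrt (2 * pi) * x * y" for x y
    by (metis (no_types, lifting) mult.assoc mult.left_commute mult_minus_left)
  have w: "wave x (0 + c *\<^sub>R y) = iexp ((- sqrt (2 * pi) * x) * y)" for x y :: real
    by (simp only: wave_def inner_real_def add_0 real_scaleR_def cis_conv_exp c2)
  show int: "integrable lborel (\<lambda>x::real. gauss x)"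
    unfolding integrable_lborel_affine_iff[OF c(1), of gauss 0, symmetric] g
    by (intro integrable_mult_right) simp
  have "(\<integral>y. complex_of_real (gauss (y::real)) * wave x y \<partial>lborel) =
     c *\<^sub>R (\<integral>y. complex_of_real (gauss ((0::real) + c *\<^sub>R y)) * wave x (0 + c *\<^sub>R y) \<partial>lborel)"
    by (subst integral_lborel_affine[OF c(1), where t=0]) (simp add: c(2))
  also have "\<dots> = c *\<^sub>R (\<integral>y. complex_of_real (sqrt (2*pi)) * (std_normal_density y *\<^sub>R iexp ((- sqrt (2*pi) * x) * y)) \<partial>lborel)"
    unfolding g
    by (intro arg_cong2[of _ _ _ _ scaleR] refl Bochner_Integration.integral_cong)
       (simp_all add: w[simplified] scaleR_conv_of_real)
  also have "\<dots> = char std_normal_distribution (- sqrt (2*pi) * x)"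
    unfolding char_def 
    by (subst integral_density) (auto simp: c_def scaleR_conv_of_real)
  also have "\<dots> = gauss x"
    unfolding char_std_normal_distribution gauss_def by (simp add: power_mult_distrib)
  finally show "(\<integral>y. complex_of_real (gauss (y::real)) * wave x y \<partial>lborel) = gauss x" .
qed

lemma gauss_eq_prod: "gauss (x::'a::euclidean_space) = (\<Prod>b\<in>Basis. gauss (x \<bullet> b))"
  unfolding gauss_def power2_norm_eq_inner euclidean_inner[of x x]
  by (simp add: sum_negf sum_distrib_left exp_sum[symmetric])

lemma wave_eq_prod: "wave x (y::'a::euclidean_space) = (\<Prod>b\<in>Basis. wave (x \<bullet> b) (y \<bullet> b))"
  unfolding wave_def cis_conv_exp euclidean_inner[of x y]
  by (simp add: sum_distrib_left sum_negf exp_sum[symmetric])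

text \<open>
  Gaussian and plane wave are products over the coordinates, so the one-dimensional integral
  gives the result by Fubini.
\<close>

lemma
  shows integrable_gauss: "integrable lborel (gauss :: 'a::euclidean_space \<Rightarrow> real)"
    and fourier_gauss: "fourier_L1 (\<lambda>y. complex_of_real (gauss y)) (x::'a) = gauss x"
proof -
  interpret product_sigma_finite "\<lambda>_::'a. lborel :: real measure" ..
  let ?P = "\<Pi>\<^sub>M b\<in>(Basis::'a set). (lborel::real measure)"
  let ?T = "\<lambda>f. \<Sum>b\<in>(Basis::'a set). f b *\<^sub>R b"
  have T[measurable]: "?T \<in> borel_measurable ?P" by measurable
  have Tb: "?T f \<bullet> b = f b" if "b \<in> Basis" for f b
    using that by (simp add: inner_sum_left inner_Basis if_distrib sum.delta cong: if_cong)
  have "integrable ?P (\<lambda>f. \<Prod>b\<in>Basis. gauss (f b))"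
    by (rule product_integrable_prod) (simp_all add: gauss_real_fourier)
  then have "integrable ?P (\<lambda>f. gauss (?T f))"
    by (subst gauss_eq_prod) (simp add: Tb cong: prod.cong)
  then show "integrable lborel (gauss :: 'a \<Rightarrow> real)"
    by (subst lborel_eq) (simp add: integrable_distr_eq)
  have "fourier_L1 (\<lambda>y. complex_of_real (gauss y)) x =
    (\<integral>f. complex_of_real (gauss (?T f)) * wave x (?T f) \<partial>?P)"
    unfolding fourier_L1_wave by (subst lborel_eq) (simp add: integral_distr)
  also have "\<dots> = (\<integral>f. (\<Prod>b\<in>Basis. complex_of_real (gauss (f b)) * wave (x \<bullet> b) (f b)) \<partial>?P)"
    by (subst gauss_eq_prod, subst wave_eq_prod) (simp add: Tb prod.distrib cong: prod.cong)
  also have "\<dots> = (\<Prod>b\<in>Basis. (\<integral>y. complex_of_real (gauss y) * wave (x \<bullet> b) y \<partial>lborel))"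
    by (rule product_integral_prod)
       (auto intro!: integrable_mult_wave integrable_of_real gauss_real_fourier)
  also have "\<dots> = gauss x"
    by (subst gauss_eq_prod[of x]) (simp add: gauss_real_fourier)
  finally show "fourier_L1 (\<lambda>y. complex_of_real (gauss y)) x = gauss x" .
qed

lemma integral_gauss: "(\<integral>x. gauss (x::'a::euclidean_space) \<partial>lborel) = 1"
proof -
  have "complex_of_real (\<integral>x. gauss (x::'a) \<partial>lborel) = 1"
    using fourier_gauss[of "0::'a"] by (simp add: fourier_L1_wave wave_def)
  then show ?thesis by (simp only: of_real_eq_1_iff)
qed

lemma integrable_gauss_scaled:
  "s \<noteq> 0 \<Longrightarrow> integrable lborel (\<lambda>x::'a::euclidean_space. gauss (s *\<^sub>R x))"
  using integrable_lborel_affine_iff[of s gauss "0::'a"] integrable_gauss by simp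

lemma integral_gauss_scaled:
  "s > 0 \<Longrightarrow> (\<integral>x. gauss (s *\<^sub>R (x::'a::euclidean_space)) \<partial>lborel) = 1 / s ^ DIM('a)"
  using integral_lborel_affine[of s gauss "0::'a"] integral_gauss[where 'a='a] by (simp add: field_simps)

lemma fourier_gauss_scaled:
  fixes x :: "'a::euclidean_space"
  assumes s: "s > 0"
  shows "fourier_L1 (\<lambda>y. complex_of_real (gauss (s *\<^sub>R y))) x = gauss (x /\<^sub>R s) / s ^ DIM('a)"
proof -
  have w: "wave (x /\<^sub>R s) (s *\<^sub>R y) = wave x y" for y
    using s by (simp add: wave_def field_simps)
  have "fourier_L1 (\<lambda>y. complex_of_real (gauss y)) (x /\<^sub>R s) =
      s ^ DIM('a) * fourier_L1 (\<lambda>y. complex_of_real (gauss (s *\<^sub>R y))) x"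
    unfolding fourier_L1_wave
    by (subst integral_lborel_affine[of s _ 0])
       (use s in \<open>auto simp: w scaleR_conv_of_real\<close>)
  then show ?thesis using s by (simp add: fourier_gauss field_simps)
qed

section \<open>The Fourier transform of integrable functions\<close>

lemma integrable_lborel_pairI:
  fixes F :: "'a::euclidean_space \<Rightarrow> 'b::euclidean_space \<Rightarrow> 'c::{banach, second_countable_topology}"
  assumes [measurable]: "(\<lambda>(x, y). F x y) \<in> borel_measurable (borel \<Otimes>\<^sub>M borel)"
    and int: "\<And>x. integrable lborel (F x)"
    and le: "\<And>x. (\<integral>y. norm (F x y) \<partial>lborel) \<le> w x"
    and w: "integrable lborel w"
  shows "integrable (lborel \<Otimes>\<^sub>M lborel) (\<lambda>(x, y). F x y)"
proof (rule lborel_pair.Fubini_integrable)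
  show "(\<lambda>(x, y). F x y) \<in> borel_measurable (lborel \<Otimes>\<^sub>M lborel)" by measurable
  have "integrable lborel (\<lambda>x. \<integral>y. norm (F x y) \<partial>lborel)"
  proof (rule Bochner_Integration.integrable_bound[OF w])
    show "(\<lambda>x. \<integral>y. norm (F x y) \<partial>lborel) \<in> borel_measurable lborel" by measurable
    show "AE x in lborel. norm (\<integral>y. norm (F x y) \<partial>lborel) \<le> norm (w x)"
      using le by (intro AE_I2) (simp add: order_trans[OF le abs_ge_self])
  qed
  then show "integrable lborel (\<lambda>x. \<integral>y. norm ((\<lambda>(x, y). F x y) (x, y)) \<partial>lborel)" by simp
  show "AE x in lborel. integrable lborel (\<lambda>y. (\<lambda>(x, y). F x y) (x, y))"
    using int by simp
qed

lemma integrable_tensor_bound: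
  fixes F :: "'a::euclidean_space \<Rightarrow> 'b::euclidean_space \<Rightarrow> complex"
  assumes [measurable]: "(\<lambda>(x, y). F x y) \<in> borel_measurable (borel \<Otimes>\<^sub>M borel)"
    and f: "integrable lborel f" and g: "integrable lborel g"
    and le: "\<And>x y. norm (F x y) \<le> f x * g y"
  shows "integrable (lborel \<Otimes>\<^sub>M lborel) (\<lambda>(x, y). F x y)"
proof (rule integrable_lborel_pairI)
  show int: "integrable lborel (F x)" for x
    by (rule Bochner_Integration.integrable_bound[OF integrable_mult_right[OF g, of "f x"]])
       (auto intro!: AE_I2 order_trans[OF le] abs_ge_self)
  show "(\<integral>y. norm (F x y) \<partial>lborel) \<le> f x * (\<integral>y. g y \<partial>lborel)" for x
    by (subst integral_mult_right_zero[symmetric], rule integral_mono)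
       (use int g le in auto)
  show "integrable lborel (\<lambda>x. f x * (\<integral>y. g y \<partial>lborel))"
    using f by simp
qed fact

lemma continuous_on_fourier_L1:
  fixes h :: "'a::euclidean_space \<Rightarrow> complex"
  assumes h: "integrable lborel h"
  shows "continuous_on UNIV (fourier_L1 h)"
  unfolding continuous_on_sequentially comp_def fourier_L1_wave
proof safe
  fix x and a :: 'a assume "(x :: nat \<Rightarrow> 'a) \<longlonglongrightarrow> a"
  note [measurable] = borel_measurable_integrable[OF h]
  show "(\<lambda>n. \<integral>y. h y * wave (x n) y \<partial>lborel) \<longlonglongrightarrow> (\<integral>y. h y * wave a y \<partial>lborel)"
  proof (rule integral_dominated_convergence[where w = "\<lambda>y. norm (h y)"])
    have "continuous_on UNIV (\<lambda>x. wave x y)" for y :: 'a by (intro continuous_intros)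
    then show "AE y in lborel. (\<lambda>n. h y * wave (x n) y) \<longlonglongrightarrow> h y * wave a y"
      using \<open>x \<longlonglongrightarrow> a\<close>
      by (intro AE_I2 tendsto_mult tendsto_const) (auto simp: continuous_on_sequentially comp_def)
  qed (use h in \<open>auto simp: norm_mult\<close>)
qed

lemma fourier_L1_measurable [measurable]:
  "integrable lborel h \<Longrightarrow> fourier_L1 h \<in> borel_measurable borel"
  by (intro borel_measurable_continuous_onI continuous_on_fourier_L1)

lemma norm_fourier_L1_le: "cmod (fourier_L1 h x) \<le> (\<integral>y. cmod (h y) \<partial>lborel)"
  unfolding fourier_L1_wave
  using integral_norm_bound[of lborel "\<lambda>y. h y * wave x y"] by (simp add: norm_mult)

lemma fourier_L1_diff:
  "integrable lborel f \<Longrightarrow> integrable lborel g \<Longrightarrow>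
    fourier_L1 (\<lambda>x. f x - g x) x = fourier_L1 f x - fourier_L1 g x"
  unfolding fourier_L1_wave by (simp add: left_diff_distrib integrable_mult_wave)

lemma integrable_fourier_mult:
  assumes f: "integrable lborel f" and g: "integrable lborel g"
  shows "integrable lborel (\<lambda>x. fourier_L1 f x * g x)"
proof (rule Bochner_Integration.integrable_bound)
  show "integrable lborel (\<lambda>x. (\<integral>y. cmod (f y) \<partial>lborel) * cmod (g x))"
    using g by simp
  note [measurable] = fourier_L1_measurable[OF f] borel_measurable_integrable[OF g]
  show "(\<lambda>x. fourier_L1 f x * g x) \<in> borel_measurable lborel" by measurable
  show "AE x in lborel. norm (fourier_L1 f x * g x) \<le> norm ((\<integral>y. cmod (f y) \<partial>lborel) * cmod (g x))"
    by (intro AE_I2)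
       (auto simp: norm_mult intro!: mult_right_mono order_trans[OF norm_fourier_L1_le] abs_ge_self)
qed

lemma fourier_multiplication:
  assumes f: "integrable lborel f" and g: "integrable lborel g"
  shows "(\<integral>x. fourier_L1 f x * g x \<partial>lborel) = (\<integral>x. f x * fourier_L1 g x \<partial>lborel)"
proof -
  note [measurable] = borel_measurable_integrable[OF f] borel_measurable_integrable[OF g]
  have "(\<integral>x. fourier_L1 f x * g x \<partial>lborel) = (\<integral>x. \<integral>y. f y * g x * wave x y \<partial>lborel \<partial>lborel)"
    unfolding fourier_L1_wave
    by (auto simp: mult_ac simp flip: integral_mult_right_zero intro!: Bochner_Integration.integral_cong)
  also have "\<dots> = (\<integral>y. \<integral>x. f y * g x * wave x y \<partial>lborel \<partial>lborel)"
  proof (rule lborel_pair.Fubini_integral)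
    show "integrable (lborel \<Otimes>\<^sub>M lborel) (\<lambda>(y, x). f y * g x * wave x y)"
      by (rule integrable_tensor_bound[where f="\<lambda>x. cmod (f x)" and g="\<lambda>x. cmod (g x)"])
         (use f g in \<open>auto simp: norm_mult\<close>)
  qed
  also have "\<dots> = (\<integral>x. f x * fourier_L1 g x \<partial>lborel)"
    unfolding fourier_L1_wave
    by (auto simp: mult_ac wave_commute simp flip: integral_mult_right_zero intro!: Bochner_Integration.integral_cong)
  finally show ?thesis .
qed

text \<open>
  Inserting a factor \<open>gauss (s x)\<close> into the integral for \<open>F(FA)\<close> turns it, by the multiplication
  formula, into the average of \<open>A\<close> against a Gaussian of width \<open>s\<close> centred at \<open>- t\<close>. As
  \<open>s \<longlonglongrightarrow> 0\<close> the inserted factor tends to 1, while the averages tend to \<open>A (- t)\<close> by continuity.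
\<close>

theorem fourier_inversion:
  fixes A :: "'a::euclidean_space \<Rightarrow> complex"
  assumes A: "integrable lborel A" and cont: "continuous_on UNIV A" and bd: "\<And>x. cmod (A x) \<le> K"
    and FA: "integrable lborel (fourier_L1 A)"
  shows "fourier_L1 (fourier_L1 A) t = A (- t)"
proof -
  define s where "s n = 1 / real (Suc n)" for n
  have s: "s n > 0" for n by (simp add: s_def)
  have s0: "s \<longlonglongrightarrow> 0" unfolding s_def by (rule LIMSEQ_inverse_real_of_nat[unfolded inverse_eq_divide])
  note [measurable] = borel_measurable_integrable[OF A] borel_measurable_integrable[OF FA]
  define g where "g n x = complex_of_real (gauss (s n *\<^sub>R x)) * wave t x" for n x
  have g: "integrable lborel (g n)" for n
    unfolding g_def using s[of n] 
    by (intro integrable_mult_wave integrable_of_real integrable_gauss_scaled) auto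
  have Fg: "fourier_L1 (g n) y = gauss ((y + t) /\<^sub>R s n) / s n ^ DIM('a)" for n y
  proof -
    have "fourier_L1 (g n) y = fourier_L1 (\<lambda>x. complex_of_real (gauss (s n *\<^sub>R x))) (y + t)"
      unfolding fourier_L1_wave g_def
      by (auto simp: wave_commute[of _ "_ :: 'a"] wave_add mult_ac intro!: Bochner_Integration.integral_cong)
    then show ?thesis by (simp add: fourier_gauss_scaled[OF s])
  qed
  have "(\<lambda>n. \<integral>x. fourier_L1 A x * g n x \<partial>lborel) \<longlonglongrightarrow> fourier_L1 (fourier_L1 A) t"
    unfolding fourier_L1_wave[of "fourier_L1 A" t]
  proof (rule integral_dominated_convergence[where w = "\<lambda>y. norm (fourier_L1 A y)"])
    show "AE x in lborel. (\<lambda>n. fourier_L1 A x * g n x) \<longlonglongrightarrow> fourier_L1 A x * wave t x"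
    proof (intro AE_I2)
      fix x :: 'a
      have "(\<lambda>n. fourier_L1 A x * g n x) \<longlonglongrightarrow> fourier_L1 A x * (complex_of_real 1 * wave t x)"
        unfolding g_def by (intro tendsto_mult tendsto_of_real tendsto_const tendsto_gauss_scaled s0)
      then show "(\<lambda>n. fourier_L1 A x * g n x) \<longlonglongrightarrow> fourier_L1 A x * wave t x" by simp
    qed
    show "AE x in lborel. norm (fourier_L1 A x * g n x) \<le> norm (fourier_L1 A x)" for n
      by (intro AE_I2) (simp add: g_def norm_mult mult_left_le)
    show "(\<lambda>x. fourier_L1 A x * g n x) \<in> borel_measurable lborel" for n
      unfolding g_def by measurable
  qed (use FA in auto)
  moreover have "(\<integral>x. fourier_L1 A x * g n x \<partial>lborel) =
      (\<integral>z. A (- t + s n *\<^sub>R z) * complex_of_real (gauss z) \<partial>lborel)" for n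
  proof -
    have "(\<integral>x. fourier_L1 A x * g n x \<partial>lborel) = (\<integral>y. A y * fourier_L1 (g n) y \<partial>lborel)"
      by (rule fourier_multiplication[OF A g])
    also have "\<dots> = s n ^ DIM('a) *\<^sub>R (\<integral>z. A (- t + s n *\<^sub>R z) * (complex_of_real (gauss z) / s n ^ DIM('a)) \<partial>lborel)"
      by (subst integral_lborel_affine[of "s n" _ "- t"]) (use s[of n] in \<open>auto simp: Fg\<close>)
    also have "\<dots> = (\<integral>z. A (- t + s n *\<^sub>R z) * complex_of_real (gauss z) \<partial>lborel)"
      using s[of n] by (simp add: scaleR_conv_of_real)
    finally show ?thesis .
  qed
  moreover have "(\<lambda>n. \<integral>z. A (- t + s n *\<^sub>R z) * complex_of_real (gauss z) \<partial>lborel) \<longlonglongrightarrow>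
     (\<integral>z. A (- t) * complex_of_real (gauss (z::'a)) \<partial>lborel)"
  proof (rule integral_dominated_convergence[where w = "\<lambda>z. K * gauss z"])
    show "AE z in lborel. (\<lambda>n. A (- t + s n *\<^sub>R z) * complex_of_real (gauss z)) \<longlonglongrightarrow> A (- t) * complex_of_real (gauss z)"
    proof (intro AE_I2 tendsto_mult tendsto_const)
      fix z :: 'a
      have c: "continuous_on UNIV (\<lambda>r. A (- t + r *\<^sub>R z))"
        by (intro continuous_on_compose2[OF cont] continuous_intros) auto
      then have "(\<lambda>n. A (- t + s n *\<^sub>R z)) \<longlonglongrightarrow> A (- t + 0 *\<^sub>R z)"
        using continuous_on_tendsto_compose[OF c s0] by simp
      then show "(\<lambda>n. A (- t + s n *\<^sub>R z)) \<longlonglongrightarrow> A (- t)" by simp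
    qed
    show "AE z in lborel. norm (A (- t + s n *\<^sub>R z) * complex_of_real (gauss z)) \<le> K * gauss z" for n
      by (intro AE_I2) (auto simp: norm_mult intro!: mult_right_mono bd)
  qed (use integrable_gauss[where 'a='a] in \<open>auto\<close>)
  moreover have "(\<integral>z. A (- t) * complex_of_real (gauss (z::'a)) \<partial>lborel) = A (- t)"
    by (simp add: integral_gauss)
  ultimately show ?thesis
    using LIMSEQ_unique by (simp add: integral_gauss)
qed

definition autocorrelation :: "('a::euclidean_space \<Rightarrow> complex) \<Rightarrow> 'a \<Rightarrow> complex" where
  "autocorrelation h t = (\<integral>y. h (y + t) * cnj (h y) \<partial>lborel)"

text \<open>
  One integrability statement for the uses of Fubini below, where the factor \<open>k\<close> is
  1, a plane wave or the value of a bounded function at \<open>- t\<close>.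
\<close>

lemma integrable_autocorrelation_kernel:
  assumes h: "integrable lborel h" and [measurable]: "(\<lambda>p. k (fst p) (snd p)) \<in> borel_measurable (borel \<Otimes>\<^sub>M borel)"
    and k: "\<And>y t. cmod (k y t) \<le> c"
  shows "integrable (lborel \<Otimes>\<^sub>M lborel) (\<lambda>(y, t). h (y + t) * cnj (h y) * k y t)"
proof (rule integrable_lborel_pairI)
  note [measurable] = borel_measurable_integrable[OF h]
  have c: "c \<ge> 0" using k[of undefined undefined] norm_ge_zero order_trans by blast
  show "(\<lambda>(y, t). h (y + t) * cnj (h y) * k y t) \<in> borel_measurable (borel \<Otimes>\<^sub>M borel)" by measurable
  have sh: "integrable lborel (\<lambda>t. h (y + t))" for y
    using h integrable_lborel_shift[of h y] by (simp add: add.commute)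
  have "(\<lambda>t. (\<lambda>p. k (fst p) (snd p)) (y, t)) \<in> borel_measurable borel" for y by measurable
  then have [measurable]: "(\<lambda>t. k y t) \<in> borel_measurable borel" for y by simp
  have le: "cmod (h (y + t) * cnj (h y) * k y t) \<le> (c * cmod (h y)) * cmod (h (y + t))" for y t
    using mult_right_mono[OF k[of y t], of "cmod (h y) * cmod (h (y + t))"]
    by (simp add: norm_mult mult_ac)
  show int: "integrable lborel (\<lambda>t. h (y + t) * cnj (h y) * k y t)" for y
    by (rule Bochner_Integration.integrable_bound[where f="\<lambda>t. (c * cmod (h y)) * cmod (h (y + t))"])
       (use sh in \<open>auto intro!: AE_I2 order_trans[OF le]\<close>)
  show "(\<integral>t. cmod (h (y + t) * cnj (h y) * k y t) \<partial>lborel) \<le> (c * cmod (h y)) * (\<integral>t. cmod (h t) \<partial>lborel)" for y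
  proof -
    have "(\<integral>t. cmod (h (y + t) * cnj (h y) * k y t) \<partial>lborel) \<le> (\<integral>t. (c * cmod (h y)) * cmod (h (t + y)) \<partial>lborel)"
      using sh[of y] int[of y] le[of y] by (intro integral_mono) (auto simp: add.commute)
    also have "\<dots> = (c * cmod (h y)) * (\<integral>t. cmod (h t) \<partial>lborel)"
      by (simp add: integral_lborel_shift[of "\<lambda>t. cmod (h t)"])
    finally show ?thesis .
  qed
  show "integrable lborel (\<lambda>y. (c * cmod (h y)) * (\<integral>t. cmod (h t) \<partial>lborel))"
    using h by simp
qed

lemma integrable_autocorrelation:
  assumes h: "integrable lborel h"
  shows "integrable lborel (autocorrelation h)"
  using lborel_pair.integrable_snd[OF integrable_autocorrelation_kernel[OF h, of "\<lambda>_ _. 1" 1]]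
  unfolding autocorrelation_def by simp

lemma fourier_autocorrelation:
  assumes h: "integrable lborel h"
  shows "fourier_L1 (autocorrelation h) x = complex_of_real ((cmod (fourier_L1 h x))\<^sup>2)"
proof -
  note [measurable] = borel_measurable_integrable[OF h]
  have "fourier_L1 (autocorrelation h) x = (\<integral>t. \<integral>y. h (y + t) * cnj (h y) * wave x t \<partial>lborel \<partial>lborel)"
    unfolding fourier_L1_wave autocorrelation_def by simp
  also have "\<dots> = (\<integral>y. \<integral>t. h (y + t) * cnj (h y) * wave x t \<partial>lborel \<partial>lborel)"
    by (rule lborel_pair.Fubini_integral, rule integrable_autocorrelation_kernel[OF h, where c=1]) auto
  also have "\<dots> = (\<integral>y. cnj (h y * wave x y) * fourier_L1 h x \<partial>lborel)"
  proof (rule Bochner_Integration.integral_cong[OF refl])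
    fix y
    have "(\<integral>t. h (y + t) * cnj (h y) * wave x t \<partial>lborel) = (\<integral>t. h t * cnj (h y) * wave x (t - y) \<partial>lborel)"
      using integral_lborel_shift[of "\<lambda>t. h t * cnj (h y) * wave x (t - y)" y] by (simp add: add.commute)
    also have "\<dots> = (\<integral>t. cnj (h y * wave x y) * (h t * wave x t) \<partial>lborel)"
      by (simp add: wave_diff mult_ac)
    finally show "(\<integral>t. h (y + t) * cnj (h y) * wave x t \<partial>lborel) = cnj (h y * wave x y) * fourier_L1 h x"
      by (simp add: fourier_L1_wave)
  qed
  also have "\<dots> = cnj (fourier_L1 h x) * fourier_L1 h x"
    by (simp add: fourier_L1_wave del: complex_cnj_mult)
  also have "\<dots> = complex_of_real ((cmod (fourier_L1 h x))\<^sup>2)"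
    by (simp only: complex_norm_square mult.commute)
  finally show ?thesis .
qed

lemma mult_norm_le_mean_square: "cmod a * cmod b \<le> ((cmod a)\<^sup>2 + (cmod b)\<^sup>2) / 2"
  using sum_squares_bound[of "cmod a" "cmod b"] by simp

text \<open>
  The arithmetic-geometric mean inequality under the integral: both \<open>|h|\<^sup>2\<close> and its translate
  have the same integral.
\<close>

lemma norm_autocorrelation_le:
  assumes [measurable]: "h \<in> borel_measurable lborel" and h2: "integrable lborel (\<lambda>x. (cmod (h x))\<^sup>2)"
  shows "cmod (autocorrelation h t) \<le> (\<integral>x. (cmod (h x))\<^sup>2 \<partial>lborel)"
proof -
  let ?w = "\<lambda>y. ((cmod (h (y + t)))\<^sup>2 + (cmod (h y))\<^sup>2) / 2"
  have sh: "integrable lborel (\<lambda>y. (cmod (h (y + t)))\<^sup>2)"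
    using integrable_lborel_shift[of "\<lambda>x. (cmod (h x))\<^sup>2" t] h2 by simp
  have w: "integrable lborel ?w" using sh h2 by simp
  have le: "cmod (h (y + t) * cnj (h y)) \<le> ?w y" for y
    using mult_norm_le_mean_square[of "h (y + t)" "h y"] by (simp add: norm_mult)
  have int: "integrable lborel (\<lambda>y. h (y + t) * cnj (h y))"
  proof (rule Bochner_Integration.integrable_bound[OF w])
    show "AE y in lborel. norm (h (y + t) * cnj (h y)) \<le> norm (?w y)"
      by (intro AE_I2 order_trans[OF le]) simp
  qed measurable
  have "cmod (autocorrelation h t) \<le> (\<integral>y. cmod (h (y + t) * cnj (h y)) \<partial>lborel)"
    unfolding autocorrelation_def by (rule integral_norm_bound)
  also have "\<dots> \<le> (\<integral>y. ?w y \<partial>lborel)"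
    by (rule integral_mono[OF integrable_norm[OF int] w le])
  also have "\<dots> = (\<integral>x. (cmod (h x))\<^sup>2 \<partial>lborel)"
    using sh h2 integral_lborel_shift[of "\<lambda>x. (cmod (h x))\<^sup>2" t] by simp
  finally show ?thesis .
qed

lemma continuous_on_autocorrelation:
  fixes h :: "'a::euclidean_space \<Rightarrow> complex"
  assumes h: "integrable lborel h" and cont: "continuous_on UNIV h" and bd: "\<And>x. cmod (h x) \<le> K"
  shows "continuous_on UNIV (autocorrelation h)"
  unfolding continuous_on_sequentially comp_def autocorrelation_def
proof safe
  fix x and a :: 'a assume x: "(x :: nat \<Rightarrow> 'a) \<longlonglongrightarrow> a"
  note [measurable] = borel_measurable_integrable[OF h]
  show "(\<lambda>n. \<integral>y. h (y + x n) * cnj (h y) \<partial>lborel) \<longlonglongrightarrow> (\<integral>y. h (y + a) * cnj (h y) \<partial>lborel)"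
  proof (rule integral_dominated_convergence[where w = "\<lambda>y. K * norm (h y)"])
    have "continuous_on UNIV (\<lambda>t. h (y + t))" for y
      by (intro continuous_on_compose2[OF cont] continuous_intros) auto
    then show "AE y in lborel. (\<lambda>n. h (y + x n) * cnj (h y)) \<longlonglongrightarrow> h (y + a) * cnj (h y)"
      using x
      by (intro AE_I2 tendsto_mult tendsto_const) (auto simp: continuous_on_sequentially comp_def)
    show "AE y in lborel. norm (h (y + x n) * cnj (h y)) \<le> K * norm (h y)" for n
      by (intro AE_I2) (auto simp: norm_mult intro!: mult_right_mono bd)
  qed (use h in \<open>auto simp: norm_mult\<close>)
qed

lemma Fatou_bounded_integrals:
  fixes f :: "nat \<Rightarrow> 'a \<Rightarrow> real"
  assumes f: "\<And>n. integrable M (f n)" and pos: "\<And>n x. 0 \<le> f n x"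
    and le: "\<And>n. n \<ge> N \<Longrightarrow> (\<integral>x. f n x \<partial>M) \<le> K"
    and lim: "AE x in M. (\<lambda>n. f n x) \<longlonglongrightarrow> g x" and [measurable]: "g \<in> borel_measurable M"
  shows "integrable M g \<and> (\<integral>x. g x \<partial>M) \<le> K"
proof -
  note [measurable] = borel_measurable_integrable[OF f]
  have "0 \<le> (\<integral>x. f N x \<partial>M)" by (simp add: pos)
  then have K: "0 \<le> K" using le[of N] by simp
  have gpos: "AE x in M. 0 \<le> g x"
    using lim by eventually_elim (use pos in \<open>auto intro: LIMSEQ_le_const\<close>)
  have "(\<integral>\<^sup>+x. ennreal (g x) \<partial>M) = (\<integral>\<^sup>+x. liminf (\<lambda>n. ennreal (f n x)) \<partial>M)"
  proof (rule nn_integral_cong_AE)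
    show "AE x in M. ennreal (g x) = liminf (\<lambda>n. ennreal (f n x))"
      using lim by eventually_elim (metis lim_imp_Liminf sequentially_bot tendsto_ennrealI)
  qed
  also have "\<dots> \<le> liminf (\<lambda>n. \<integral>\<^sup>+x. ennreal (f n x) \<partial>M)"
    by (rule nn_integral_liminf) simp
  also have "\<dots> \<le> ennreal K"
  proof -
    have "(\<integral>\<^sup>+x. ennreal (f n x) \<partial>M) \<le> ennreal K" if "n \<ge> N" for n
      using le[OF that] f pos by (subst nn_integral_eq_integral) (auto intro: ennreal_leI)
    then have "eventually (\<lambda>n. (\<integral>\<^sup>+x. ennreal (f n x) \<partial>M) \<le> ennreal K) sequentially"
      by (auto simp: eventually_sequentially)
    then have "liminf (\<lambda>n. \<integral>\<^sup>+x. ennreal (f n x) \<partial>M) \<le> liminf (\<lambda>n. ennreal K)"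
      by (rule Liminf_mono)
    then show ?thesis by (simp add: Liminf_const)
  qed
  finally have nn: "(\<integral>\<^sup>+x. ennreal (g x) \<partial>M) \<le> ennreal K" .
  have "(\<integral>\<^sup>+x. ennreal (g x) \<partial>M) < \<infinity>"
    using nn by (rule order_le_less_trans) simp
  then have int: "integrable M g"
    using gpos by (intro integrableI_nonneg) auto
  with nn show ?thesis using gpos K
    by (simp add: nn_integral_eq_integral)
qed

text \<open>
  Since \<open>|Fh|\<^sup>2\<close> is the transform of the autocorrelation, the multiplication formula writes
  \<open>\<integral> |Fh|\<^sup>2 gauss (s x)\<close> as an average of the autocorrelation against a Gaussian probability
  density. The autocorrelation is bounded by \<open>\<integral> |h|\<^sup>2\<close>, and Fatou's lemma lets \<open>s \<longlonglongrightarrow> 0\<close>.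
\<close>

theorem bessel_fourier_L1:
  fixes h :: "'a::euclidean_space \<Rightarrow> complex"
  assumes h: "integrable lborel h" and h2: "integrable lborel (\<lambda>x. (cmod (h x))\<^sup>2)"
  shows "integrable lborel (\<lambda>x. (cmod (fourier_L1 h x))\<^sup>2) \<and>
     (\<integral>x. (cmod (fourier_L1 h x))\<^sup>2 \<partial>lborel) \<le> (\<integral>x. (cmod (h x))\<^sup>2 \<partial>lborel)"
proof (rule Fatou_bounded_integrals[where N=0])
  define s where "s n = 1 / real (Suc n)" for n
  have s: "s n > 0" for n by (simp add: s_def)
  have s0: "s \<longlonglongrightarrow> 0" unfolding s_def by (rule LIMSEQ_inverse_real_of_nat[unfolded inverse_eq_divide])
  note [measurable] = borel_measurable_integrable[OF h] fourier_L1_measurable[OF h]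
  let ?A = "autocorrelation h" and ?N = "\<integral>x. (cmod (h x))\<^sup>2 \<partial>lborel"
  let ?f = "\<lambda>n x. (cmod (fourier_L1 h x))\<^sup>2 * gauss (s n *\<^sub>R x)"
  let ?G = "\<lambda>n x. complex_of_real (gauss (s n *\<^sub>R x))"
  have N: "?N \<ge> 0" by simp
  have A: "integrable lborel ?A" by (rule integrable_autocorrelation[OF h])
  have G: "integrable lborel (?G n)" for n
    using s[of n] by (intro integrable_of_real integrable_gauss_scaled) simp
  have cf: "complex_of_real (?f n x) = fourier_L1 ?A x * ?G n x" for n x
    by (simp add: fourier_autocorrelation[OF h])
  have "integrable lborel (\<lambda>x. complex_of_real (?f n x))" for n
    unfolding cf by (rule integrable_fourier_mult[OF A G])
  then show "integrable lborel (?f n)" for n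
    by (simp only: complex_of_real_integrable_eq)
  show "(\<integral>x. ?f n x \<partial>lborel) \<le> ?N" for n
  proof -
    have FG: "fourier_L1 (?G n) x = complex_of_real (gauss (x /\<^sub>R s n) / s n ^ DIM('a))" for x :: 'a
      by (simp add: fourier_gauss_scaled[OF s])
    have Gi: "integrable lborel (\<lambda>x::'a. gauss (x /\<^sub>R s n) / s n ^ DIM('a))"
      using s[of n] integrable_gauss_scaled[of "inverse (s n)"] by (simp add: divide_inverse)
    have "complex_of_real (\<integral>x. ?f n x \<partial>lborel) = (\<integral>x. fourier_L1 ?A x * ?G n x \<partial>lborel)"
      unfolding cf[symmetric] by (rule integral_complex_of_real[symmetric])
    also have "\<dots> = (\<integral>x. ?A x * fourier_L1 (?G n) x \<partial>lborel)"
      by (rule fourier_multiplication[OF A G])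
    finally have eq: "complex_of_real (\<integral>x. ?f n x \<partial>lborel) = (\<integral>x. ?A x * fourier_L1 (?G n) x \<partial>lborel)" .
    have "(\<integral>x. ?f n x \<partial>lborel) \<le> cmod (complex_of_real (\<integral>x. ?f n x \<partial>lborel))"
      unfolding norm_of_real by (rule abs_ge_self)
    also have "\<dots> = cmod (\<integral>x. ?A x * fourier_L1 (?G n) x \<partial>lborel)"
      by (simp only: eq)
    also have "\<dots> \<le> (\<integral>x. cmod (?A x * fourier_L1 (?G n) x) \<partial>lborel)"
      by (rule integral_norm_bound)
    also have "\<dots> \<le> (\<integral>x. ?N * (gauss ((x::'a) /\<^sub>R s n) / s n ^ DIM('a)) \<partial>lborel)"
    proof (rule integral_mono)
      show "integrable lborel (\<lambda>x. cmod (?A x * fourier_L1 (?G n) x))"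
        using integrable_fourier_mult[OF G A, of n] by (simp add: mult.commute)
      show "integrable lborel (\<lambda>x::'a. ?N * (gauss (x /\<^sub>R s n) / s n ^ DIM('a)))"
        using Gi by (intro integrable_mult_right)
      show "cmod (?A x * fourier_L1 (?G n) x) \<le> ?N * (gauss (x /\<^sub>R s n) / s n ^ DIM('a))" for x
        unfolding norm_mult FG norm_of_real using s[of n]
        by (intro mult_mono norm_autocorrelation_le h2 N) auto
    qed
    also have "\<dots> = ?N"
      using s[of n] integral_gauss_scaled[of "inverse (s n)", where 'a='a]
      by (simp add: power_inverse field_simps)
    finally show ?thesis .
  qed
  show "AE x in lborel. (\<lambda>n. ?f n x) \<longlonglongrightarrow> (cmod (fourier_L1 h x))\<^sup>2"
  proof (intro AE_I2)
    fix x :: 'a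
    have "(\<lambda>n. ?f n x) \<longlonglongrightarrow> (cmod (fourier_L1 h x))\<^sup>2 * 1"
      by (intro tendsto_mult tendsto_const tendsto_gauss_scaled s0)
    then show "(\<lambda>n. ?f n x) \<longlonglongrightarrow> (cmod (fourier_L1 h x))\<^sup>2" by simp
  qed
  have [measurable]: "fourier_L1 h \<in> borel_measurable borel" by (rule fourier_L1_measurable[OF h])
  show "(\<lambda>x. (cmod (fourier_L1 h x))\<^sup>2) \<in> borel_measurable lborel" by measurable
qed auto

section \<open>Square-integrable functions\<close>

lemma L2D: "f \<in> L2 M \<Longrightarrow> f \<in> borel_measurable M" "f \<in> L2 M \<Longrightarrow> integrable M (\<lambda>x. (cmod (f x))\<^sup>2)"
  by (simp_all add: L2_def)

lemma L2_mult:
  assumes "f \<in> L2 M" "g \<in> L2 M"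
  shows "integrable M (\<lambda>x. f x * g x)"
proof (rule Bochner_Integration.integrable_bound)
  note [measurable] = L2D(1)[OF assms(1)] L2D(1)[OF assms(2)]
  show "integrable M (\<lambda>x. ((cmod (f x))\<^sup>2 + (cmod (g x))\<^sup>2) / 2)"
    using assms by (simp add: L2D)
  show "AE x in M. norm (f x * g x) \<le> norm (((cmod (f x))\<^sup>2 + (cmod (g x))\<^sup>2) / 2)"
    by (intro AE_I2) (use mult_norm_le_mean_square in \<open>auto simp: norm_mult\<close>)
  show "(\<lambda>x. f x * g x) \<in> borel_measurable M" by measurable
qed

lemma norm_add_square_le: "(cmod (a + b))\<^sup>2 \<le> 2 * (cmod a)\<^sup>2 + 2 * (cmod b)\<^sup>2"
proof -
  have "(cmod (a + b))\<^sup>2 \<le> (cmod a + cmod b)\<^sup>2"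
    by (intro power_mono norm_triangle_ineq) simp
  also have "\<dots> \<le> 2 * (cmod a)\<^sup>2 + 2 * (cmod b)\<^sup>2"
    using sum_squares_bound[of "cmod a" "cmod b"] by (simp add: power2_sum)
  finally show ?thesis .
qed

lemma L2_add:
  assumes "f \<in> L2 M" "g \<in> L2 M"
  shows "(\<lambda>x. f x + g x) \<in> L2 M"
proof -
  note [measurable] = L2D(1)[OF assms(1)] L2D(1)[OF assms(2)]
  have "integrable M (\<lambda>x. (cmod (f x + g x))\<^sup>2)"
  proof (rule Bochner_Integration.integrable_bound)
    show "integrable M (\<lambda>x. 2 * (cmod (f x))\<^sup>2 + 2 * (cmod (g x))\<^sup>2)"
      using assms by (simp add: L2D)
    show "AE x in M. norm ((cmod (f x + g x))\<^sup>2) \<le> norm (2 * (cmod (f x))\<^sup>2 + 2 * (cmod (g x))\<^sup>2)"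
      using norm_add_square_le by simp
  qed measurable
  then show ?thesis by (simp add: L2_def)
qed

lemma L2_cmult: "f \<in> L2 M \<Longrightarrow> (\<lambda>x. c * f x) \<in> L2 M"
  by (auto simp: L2_def norm_mult power_mult_distrib)

lemma L2_diff: "f \<in> L2 M \<Longrightarrow> g \<in> L2 M \<Longrightarrow> (\<lambda>x. f x - g x) \<in> L2 M"
  using L2_add[of f M "\<lambda>x. -1 * g x"] L2_cmult[of g M "-1"] by simp

lemma L2_cnj: "f \<in> L2 M \<Longrightarrow> (\<lambda>x. cnj (f x)) \<in> L2 M"
  by (auto simp: L2_def)

lemma L2_of_bounded:
  assumes f: "integrable M f" and bd: "\<And>x. cmod (f x) \<le> K"
  shows "f \<in> L2 M"
proof -
  note [measurable] = borel_measurable_integrable[OF f]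
  have "integrable M (\<lambda>x. (cmod (f x))\<^sup>2)"
  proof (rule Bochner_Integration.integrable_bound)
    show "integrable M (\<lambda>x. K * cmod (f x))" using f by simp
    show "AE x in M. norm ((cmod (f x))\<^sup>2) \<le> norm (K * cmod (f x))"
      by (intro AE_I2) (auto simp: power2_eq_square intro!: order_trans[OF mult_right_mono[OF bd] abs_ge_self])
  qed measurable
  then show ?thesis by (simp add: L2_def)
qed

lemma Cauchy_Schwarz_L2:
  assumes "f \<in> L2 M" "g \<in> L2 M"
  shows "(\<integral>x. cmod (f x) * cmod (g x) \<partial>M)\<^sup>2 \<le> (\<integral>x. (cmod (f x))\<^sup>2 \<partial>M) * (\<integral>x. (cmod (g x))\<^sup>2 \<partial>M)"
proof -
  note [measurable] = L2D(1)[OF assms(1)] L2D(1)[OF assms(2)]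
  have int: "integrable M (\<lambda>x. cmod (f x) * cmod (g x))"
    using integrable_norm[OF L2_mult[OF assms]] by (simp add: norm_mult)
  have "ennreal ((\<integral>x. cmod (f x) * cmod (g x) \<partial>M)\<^sup>2) = (\<integral>\<^sup>+x. ennreal (cmod (f x)) * ennreal (cmod (g x)) \<partial>M)\<^sup>2"
    using int by (simp add: nn_integral_eq_integral ennreal_power flip: ennreal_mult)
  also have "\<dots> \<le> (\<integral>\<^sup>+x. (ennreal (cmod (f x)))\<^sup>2 \<partial>M) * (\<integral>\<^sup>+x. (ennreal (cmod (g x)))\<^sup>2 \<partial>M)"
    by (rule Cauchy_Schwarz_nn_integral) auto
  also have "\<dots> = ennreal ((\<integral>x. (cmod (f x))\<^sup>2 \<partial>M) * (\<integral>x. (cmod (g x))\<^sup>2 \<partial>M))"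
    using assms by (simp add: L2D nn_integral_eq_integral ennreal_power ennreal_mult)
  finally show ?thesis by (subst (asm) ennreal_le_iff) auto
qed

lemma Cauchy_Schwarz_L2_dist:
  assumes "f \<in> L2 M" "g \<in> L2 M" "k \<in> L2 M"
  shows "cmod ((\<integral>x. f x * k x \<partial>M) - (\<integral>x. g x * k x \<partial>M)) \<le> L2_dist M f g * sqrt (\<integral>x. (cmod (k x))\<^sup>2 \<partial>M)"
proof -
  have "(\<integral>x. f x * k x \<partial>M) - (\<integral>x. g x * k x \<partial>M) = (\<integral>x. (f x - g x) * k x \<partial>M)"
    using assms by (simp add: L2_mult left_diff_distrib)
  then have "cmod ((\<integral>x. f x * k x \<partial>M) - (\<integral>x. g x * k x \<partial>M)) \<le> (\<integral>x. cmod (f x - g x) * cmod (k x) \<partial>M)"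
    using integral_norm_bound[of M "\<lambda>x. (f x - g x) * k x"] by (simp add: norm_mult)
  also have "\<dots> \<le> sqrt ((\<integral>x. (cmod (f x - g x))\<^sup>2 \<partial>M) * (\<integral>x. (cmod (k x))\<^sup>2 \<partial>M))"
    by (rule real_le_rsqrt[OF Cauchy_Schwarz_L2[OF L2_diff[OF assms(1,2)] assms(3)]])
  finally show ?thesis by (simp add: L2_dist_def real_sqrt_mult)
qed

lemma tendsto_integral_L2_mult:
  assumes h: "\<And>n. h n \<in> L2 M" and f: "f \<in> L2 M" and g: "g \<in> L2 M"
    and lim: "(\<lambda>n. L2_dist M (h n) f) \<longlonglongrightarrow> 0"
  shows "(\<lambda>n. \<integral>x. h n x * g x \<partial>M) \<longlonglongrightarrow> (\<integral>x. f x * g x \<partial>M)"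
proof -
  have "(\<lambda>n. (\<integral>x. h n x * g x \<partial>M) - (\<integral>x. f x * g x \<partial>M)) \<longlonglongrightarrow> 0"
  proof (rule Lim_null_comparison)
    show "\<forall>\<^sub>F n in sequentially. norm ((\<integral>x. h n x * g x \<partial>M) - (\<integral>x. f x * g x \<partial>M)) \<le>
        L2_dist M (h n) f * sqrt (\<integral>x. (cmod (g x))\<^sup>2 \<partial>M)"
      by (intro always_eventually allI Cauchy_Schwarz_L2_dist h f g)
    show "(\<lambda>n. L2_dist M (h n) f * sqrt (\<integral>x. (cmod (g x))\<^sup>2 \<partial>M)) \<longlonglongrightarrow> 0"
      by (rule tendsto_mult_left_zero[OF lim])
  qed
  then show ?thesis by (rule LIM_zero_cancel)
qed

text \<open>
  Multiplication by the Gaussian maps \<open>L\<^sup>2\<close> continuously into \<open>L\<^sup>1\<close>, where a Cauchy sequence has an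
  almost everywhere convergent subsequence. As the Gaussian vanishes nowhere, the original
  subsequence converges almost everywhere too, and Fatou's lemma turns this into \<open>L\<^sup>2\<close> convergence.
\<close>

lemma L2_lborel_complete:
  fixes f :: "nat \<Rightarrow> 'a::euclidean_space \<Rightarrow> complex"
  assumes f: "\<And>n. f n \<in> L2 lborel"
    and Cauchy: "\<And>e. e > 0 \<Longrightarrow> \<exists>N. \<forall>i\<ge>N. \<forall>j\<ge>N. (\<integral>x. (cmod (f i x - f j x))\<^sup>2 \<partial>lborel) < e"
  shows "\<exists>g \<in> L2 lborel. (\<lambda>n. L2_dist lborel (f n) g) \<longlonglongrightarrow> 0"
proof -
  note [measurable] = L2D(1)[OF f]
  define G :: "'a \<Rightarrow> complex" where "G x = complex_of_real (gauss x)" for x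
  have G1: "integrable lborel G" unfolding G_def by (intro integrable_of_real integrable_gauss)
  have G: "G \<in> L2 lborel" by (rule L2_of_bounded[OF G1, where K=1]) (simp add: G_def)
  define s where "s n x = f n x * G x" for n x
  define K where "K = (\<integral>x. (cmod (G x))\<^sup>2 \<partial>lborel)"
  have K: "K \<ge> 0" by (simp add: K_def)
  have s: "integrable lborel (s n)" for n unfolding s_def by (rule L2_mult[OF f G])
  have sC: "\<exists>N. \<forall>i\<ge>N. \<forall>j\<ge>N. (\<integral>x. norm (s i x - s j x) \<partial>lborel) < e" if e: "e > 0" for e :: real
  proof -
    have "e\<^sup>2 / (K + 1) > 0" using e K by simp
    from Cauchy[OF this] obtain N where
      N: "\<And>i j. i \<ge> N \<Longrightarrow> j \<ge> N \<Longrightarrow> (\<integral>x. (cmod (f i x - f j x))\<^sup>2 \<partial>lborel) < e\<^sup>2 / (K + 1)" by blast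
    have "(\<integral>x. norm (s i x - s j x) \<partial>lborel) < e" if "i \<ge> N" "j \<ge> N" for i j
    proof (rule power2_less_imp_less)
      have "(\<integral>x. norm (s i x - s j x) \<partial>lborel)\<^sup>2 = (\<integral>x. cmod (f i x - f j x) * cmod (G x) \<partial>lborel)\<^sup>2"
        by (simp add: s_def left_diff_distrib[symmetric] norm_mult)
      also have "\<dots> \<le> (\<integral>x. (cmod (f i x - f j x))\<^sup>2 \<partial>lborel) * K"
        unfolding K_def by (rule Cauchy_Schwarz_L2[OF L2_diff[OF f f] G])
      also have "\<dots> \<le> e\<^sup>2 / (K + 1) * K"
        using N[OF that] K by (intro mult_right_mono) auto
      also have "\<dots> < e\<^sup>2" using e K by (simp add: field_simps)
      finally show "(\<integral>x. norm (s i x - s j x) \<partial>lborel)\<^sup>2 < e\<^sup>2" .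
    qed (use e in simp)
    then show ?thesis by blast
  qed
  obtain r where r: "strict_mono r" and AEr: "AE x in lborel. Cauchy (\<lambda>i. s (r i) x)"
    using cauchy_L1_AE_cauchy_subseq[OF s sC] by blast
  define g where "g x = lim (\<lambda>i. f (r i) x)" for x
  have [measurable]: "g \<in> borel_measurable lborel" unfolding g_def by measurable
  have lim: "AE x in lborel. (\<lambda>i. f (r i) x) \<longlonglongrightarrow> g x"
    using AEr
  proof eventually_elim
    fix x assume "Cauchy (\<lambda>i. s (r i) x)"
    then obtain l where "(\<lambda>i. s (r i) x) \<longlonglongrightarrow> l" by (auto simp: Cauchy_convergent_iff convergent_def)
    from tendsto_divide[OF this tendsto_const[of "G x"]]
    have "(\<lambda>i. f (r i) x) \<longlonglongrightarrow> l / G x"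
      using gauss_pos[of x] by (simp add: s_def G_def less_imp_neq[symmetric])
    then have "convergent (\<lambda>i. f (r i) x)" by (auto simp: convergent_def)
    then show "(\<lambda>i. f (r i) x) \<longlonglongrightarrow> g x" by (simp add: g_def convergent_LIMSEQ_iff)
  qed
  have fg: "\<exists>N. \<forall>n\<ge>N. integrable lborel (\<lambda>x. (cmod (f n x - g x))\<^sup>2) \<and> (\<integral>x. (cmod (f n x - g x))\<^sup>2 \<partial>lborel) \<le> e"
    if "e > 0" for e
  proof -
    from Cauchy[OF that] obtain N where
      N: "\<And>i j. i \<ge> N \<Longrightarrow> j \<ge> N \<Longrightarrow> (\<integral>x. (cmod (f i x - f j x))\<^sup>2 \<partial>lborel) < e" by blast
    have "integrable lborel (\<lambda>x. (cmod (f n x - g x))\<^sup>2) \<and> (\<integral>x. (cmod (f n x - g x))\<^sup>2 \<partial>lborel) \<le> e" if n: "n \<ge> N" for n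
    proof (rule Fatou_bounded_integrals[where f = "\<lambda>j x. (cmod (f n x - f (r j) x))\<^sup>2" and N=N])
      show "integrable lborel (\<lambda>x. (cmod (f n x - f (r j) x))\<^sup>2)" for j
        by (rule L2D(2)[OF L2_diff[OF f f]])
      show "(\<integral>x. (cmod (f n x - f (r j) x))\<^sup>2 \<partial>lborel) \<le> e" if "j \<ge> N" for j
        using N[OF n, of "r j"] that seq_suble[OF r, of j] by simp
      show "AE x in lborel. (\<lambda>j. (cmod (f n x - f (r j) x))\<^sup>2) \<longlonglongrightarrow> (cmod (f n x - g x))\<^sup>2"
        using lim by eventually_elim (intro tendsto_intros)
    qed auto
    then show ?thesis by blast
  qed
  have "g \<in> L2 lborel"
  proof -
    obtain n where "integrable lborel (\<lambda>x. (cmod (f n x - g x))\<^sup>2)"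
      using fg[of 1] by auto
    then have "(\<lambda>x. f n x - g x) \<in> L2 lborel" by (simp add: L2_def)
    from L2_diff[OF f[of n] this] show ?thesis by simp
  qed
  moreover have "(\<lambda>n. (\<integral>x. (cmod (f n x - g x))\<^sup>2 \<partial>lborel)) \<longlonglongrightarrow> 0"
  proof (rule LIMSEQ_I)
    fix e :: real assume "e > 0"
    then obtain N where "\<And>n. n \<ge> N \<Longrightarrow> (\<integral>x. (cmod (f n x - g x))\<^sup>2 \<partial>lborel) \<le> e / 2"
      using fg[of "e / 2"] by auto
    then show "\<exists>N. \<forall>n\<ge>N. norm ((\<integral>x. (cmod (f n x - g x))\<^sup>2 \<partial>lborel) - 0) < e"
      using \<open>e > 0\<close> by (intro exI[of _ N]) force
  qed
  then have "(\<lambda>n. L2_dist lborel (f n) g) \<longlonglongrightarrow> 0"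
    unfolding L2_dist_def using tendsto_real_sqrt by fastforce
  ultimately show ?thesis by blast
qed

section \<open>Existence of the spectral density\<close>

text \<open>
  Membership in \<open>L\<^sup>2\<close> is what gives the convergence in \<open>has_fourier_L2\<close> its meaning:
  \<open>L2_dist\<close> is 0 by convention when the squared difference is not integrable.
\<close>

lemma fourier_L1_in_L2:
  assumes "h \<in> L1 lborel \<inter> L2 lborel"
  shows "fourier_L1 h \<in> L2 lborel"
    and "(\<integral>x. (cmod (fourier_L1 h x))\<^sup>2 \<partial>lborel) \<le> (\<integral>x. (cmod (h x))\<^sup>2 \<partial>lborel)"
  using assms bessel_fourier_L1[of h] fourier_L1_measurable[of h] by (auto simp: L1_def L2_def)

text \<open>
  A bounded \<open>L\<^sup>2\<close> function becomes integrable when multiplied by a Gaussian. Widening the Gaussian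
  gives an approximating sequence whose transforms are Cauchy by Bessel's inequality.
\<close>

lemma exists_fourier_L2:
  fixes f :: "'a::euclidean_space \<Rightarrow> complex"
  assumes f: "f \<in> L2 lborel" and bd: "\<And>x. cmod (f x) \<le> K"
  shows "\<exists>g. has_fourier_L2 f g"
proof -
  define s where "s n = 1 / real (Suc n)" for n
  have s: "s n > 0" for n by (simp add: s_def)
  have s0: "s \<longlonglongrightarrow> 0" unfolding s_def by (rule LIMSEQ_inverse_real_of_nat[unfolded inverse_eq_divide])
  note [measurable] = L2D(1)[OF f]
  define h where "h n x = f x * complex_of_real (gauss (s n *\<^sub>R x))" for n x
  have [measurable]: "h n \<in> borel_measurable lborel" for n unfolding h_def by measurable
  have hle: "cmod (h n x) \<le> cmod (f x)" for n x
    by (simp add: h_def norm_mult mult_left_le)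
  have h1: "integrable lborel (h n)" for n
  proof (rule Bochner_Integration.integrable_bound)
    show "integrable lborel (\<lambda>x::'a. K * gauss (s n *\<^sub>R x))"
      using s[of n] integrable_gauss_scaled[of "s n", where 'a='a] by simp
    show "AE x in lborel. norm (h n x) \<le> norm (K * gauss (s n *\<^sub>R x))"
    proof (intro AE_I2)
      fix x
      have "norm (h n x) \<le> K * gauss (s n *\<^sub>R x)"
        by (auto simp: h_def norm_mult intro!: mult_right_mono bd)
      then show "norm (h n x) \<le> norm (K * gauss (s n *\<^sub>R x))" by simp
    qed
  qed measurable
  have h2: "h n \<in> L2 lborel" for n
    by (rule L2_of_bounded[OF h1]) (rule order_trans[OF hle bd])
  have h: "h n \<in> L1 lborel \<inter> L2 lborel" for n using h1 h2 by (simp add: L1_def)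
  define d where "d n = (\<integral>x. (cmod (h n x - f x))\<^sup>2 \<partial>lborel)" for n
  have d0: "d \<longlonglongrightarrow> 0"
  proof -
    have "d \<longlonglongrightarrow> integral\<^sup>L lborel (\<lambda>x::'a. 0)" unfolding d_def
    proof (rule integral_dominated_convergence[where w = "\<lambda>x. (cmod (f x))\<^sup>2"])
      show "AE x in lborel. (\<lambda>n. (cmod (h n x - f x))\<^sup>2) \<longlonglongrightarrow> 0"
      proof (intro AE_I2)
        fix x :: 'a
        have "(\<lambda>n. (cmod (h n x - f x))\<^sup>2) \<longlonglongrightarrow> (cmod (f x * complex_of_real 1 - f x))\<^sup>2"
          unfolding h_def by (intro tendsto_intros tendsto_gauss_scaled s0)
        then show "(\<lambda>n. (cmod (h n x - f x))\<^sup>2) \<longlonglongrightarrow> 0" by simp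
      qed
      show "AE x in lborel. norm ((cmod (h n x - f x))\<^sup>2) \<le> (cmod (f x))\<^sup>2" for n
      proof (intro AE_I2)
        fix x :: 'a
        have "cmod (h n x - f x) = cmod (f x) * \<bar>gauss (s n *\<^sub>R x) - 1\<bar>"
        proof -
          have "h n x - f x = f x * complex_of_real (gauss (s n *\<^sub>R x) - 1)"
            by (simp add: h_def algebra_simps)
          then show ?thesis by (simp only: norm_mult norm_of_real)
        qed
        also have "\<dots> \<le> cmod (f x) * 1"
          using gauss_nonneg[of "s n *\<^sub>R x"] gauss_le_1[of "s n *\<^sub>R x"] by (intro mult_left_mono) auto
        finally show "norm ((cmod (h n x - f x))\<^sup>2) \<le> (cmod (f x))\<^sup>2"
          by simp
      qed
    qed (use f in \<open>auto simp: L2D\<close>)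
    then show ?thesis by simp
  qed
  have dd: "(\<integral>x. (cmod (fourier_L1 (h i) x - fourier_L1 (h j) x))\<^sup>2 \<partial>lborel) \<le> 2 * d i + 2 * d j" for i j
  proof -
    have hh: "(\<lambda>x. h i x - h j x) \<in> L1 lborel \<inter> L2 lborel"
      using h1 h2 by (auto simp: L1_def intro: L2_diff)
    have "(\<integral>x. (cmod (fourier_L1 (h i) x - fourier_L1 (h j) x))\<^sup>2 \<partial>lborel) \<le> (\<integral>x. (cmod (h i x - h j x))\<^sup>2 \<partial>lborel)"
      using fourier_L1_in_L2(2)[OF hh] by (simp add: fourier_L1_diff[OF h1 h1])
    also have "\<dots> \<le> (\<integral>x. 2 * (cmod (h i x - f x))\<^sup>2 + 2 * (cmod (h j x - f x))\<^sup>2 \<partial>lborel)"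
    proof (rule integral_mono)
      show "integrable lborel (\<lambda>x. (cmod (h i x - h j x))\<^sup>2)" using hh by (simp add: L2D)
      show "integrable lborel (\<lambda>x. 2 * (cmod (h i x - f x))\<^sup>2 + 2 * (cmod (h j x - f x))\<^sup>2)"
        using L2D(2)[OF L2_diff[OF h2 f]] by simp
      show "(cmod (h i x - h j x))\<^sup>2 \<le> 2 * (cmod (h i x - f x))\<^sup>2 + 2 * (cmod (h j x - f x))\<^sup>2" for x
      proof -
        have "(cmod (h i x - h j x))\<^sup>2 \<le> (cmod (h i x - f x) + cmod (h j x - f x))\<^sup>2"
          using norm_triangle_ineq4[of "h i x - f x" "h j x - f x"] by (intro power_mono) auto
        then show ?thesis using sum_squares_bound[of "cmod (h i x - f x)" "cmod (h j x - f x)"]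
          by (simp add: power2_sum)
      qed
    qed
    also have "\<dots> = 2 * d i + 2 * d j"
      using L2D(2)[OF L2_diff[OF h2 f]] by (simp add: d_def)
    finally show ?thesis .
  qed
  have "\<exists>g\<in>L2 lborel. (\<lambda>n. L2_dist lborel (fourier_L1 (h n)) g) \<longlonglongrightarrow> 0"
  proof (rule L2_lborel_complete)
    show "fourier_L1 (h n) \<in> L2 lborel" for n by (rule fourier_L1_in_L2(1)[OF h])
    fix e :: real assume "e > 0"
    then have "e / 4 > 0" by simp
    from LIMSEQ_D[OF d0 this] obtain N where N: "\<And>n. n \<ge> N \<Longrightarrow> \<bar>d n\<bar> < e / 4" by auto
    show "\<exists>N. \<forall>i\<ge>N. \<forall>j\<ge>N. (\<integral>x. (cmod (fourier_L1 (h i) x - fourier_L1 (h j) x))\<^sup>2 \<partial>lborel) < e"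
    proof (intro exI[of _ N] allI impI)
      fix i j assume "i \<ge> N" "j \<ge> N"
      then show "(\<integral>x. (cmod (fourier_L1 (h i) x - fourier_L1 (h j) x))\<^sup>2 \<partial>lborel) < e"
        using dd[of i j] N[of i] N[of j] by linarith
    qed
  qed
  then obtain g where g: "g \<in> L2 lborel" "(\<lambda>n. L2_dist lborel (fourier_L1 (h n)) g) \<longlonglongrightarrow> 0" by blast
  have "(\<lambda>n. L2_dist lborel (h n) f) \<longlonglongrightarrow> 0"
    using tendsto_real_sqrt[OF d0] by (simp add: L2_dist_def d_def)
  with g f h have "has_fourier_L2 f g"
    unfolding has_fourier_L2_def by blast
  then show ?thesis by blast
qed

section \<open>The quadratic form of a stationary kernel\<close>

definition quadratic_form :: "('a::euclidean_space \<Rightarrow> complex) \<Rightarrow> ('a \<Rightarrow> complex) \<Rightarrow> complex" where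
  "quadratic_form f h = (\<integral>x. (\<integral>y. f (x - y) * h y \<partial>lborel) * cnj (h x) \<partial>lborel)"

lemma quadratic_form_autocorrelation:
  fixes f :: "'a::euclidean_space \<Rightarrow> complex"
  assumes [measurable]: "f \<in> borel_measurable lborel" and bd: "\<And>x. cmod (f x) \<le> K" and h: "integrable lborel h"
  shows "quadratic_form f h = (\<integral>t. f t * autocorrelation h (- t) \<partial>lborel)"
proof -
  have "quadratic_form f h = (\<integral>x. \<integral>t. h (x + t) * cnj (h x) * f (- t) \<partial>lborel \<partial>lborel)"
    unfolding quadratic_form_def
  proof (rule Bochner_Integration.integral_cong[OF refl])
    fix x
    have "(\<integral>y. f (x - y) * h y \<partial>lborel) * cnj (h x) = (\<integral>y. f (x - y) * h y * cnj (h x) \<partial>lborel)"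
      by simp
    also have "\<dots> = (\<integral>t. h (x + t) * cnj (h x) * f (- t) \<partial>lborel)"
      using integral_lborel_shift[of "\<lambda>y. f (x - y) * h y * cnj (h x)" x] by (simp add: mult_ac add.commute)
    finally show "(\<integral>y. f (x - y) * h y \<partial>lborel) * cnj (h x) = (\<integral>t. h (x + t) * cnj (h x) * f (- t) \<partial>lborel)" .
  qed
  also have "\<dots> = (\<integral>t. \<integral>x. h (x + t) * cnj (h x) * f (- t) \<partial>lborel \<partial>lborel)"
    by (rule lborel_pair.Fubini_integral[symmetric], rule integrable_autocorrelation_kernel[OF h, where c=K])
       (use bd in auto)
  also have "\<dots> = (\<integral>t. f (- t) * autocorrelation h t \<partial>lborel)"
    by (simp add: autocorrelation_def mult.commute)
  also have "\<dots> = (\<integral>t. f t * autocorrelation h (- t) \<partial>lborel)"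
    using integral_lborel_reflect[of "\<lambda>t. f (- t) * autocorrelation h t" 0] by simp
  finally show ?thesis .
qed

text \<open>
  With \<open>A\<close> the autocorrelation of \<open>h\<close> and \<open>B = |Fh|\<^sup>2 = FA\<close>, inversion gives \<open>FB t = A (- t)\<close>,
  so the multiplication formula reads \<open>\<integral> Fk B = \<integral> k(t) A (- t) dt\<close> for integrable \<open>k\<close>.
  Both sides are continuous in \<open>k\<close> and \<open>Fk\<close> for the \<open>L\<^sup>2\<close> distance because \<open>A\<close> and \<open>B\<close> are
  bounded and integrable, hence in \<open>L\<^sup>2\<close>. They therefore pass to the limit \<open>k \<longlonglongrightarrow> f\<close>, \<open>Fk \<longlonglongrightarrow> \<phi>\<close>.
\<close>

theorem quadratic_form_spectral:
  fixes f :: "'a::euclidean_space \<Rightarrow> complex"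
  assumes \<phi>: "has_fourier_L2 f \<phi>" and bd: "\<And>x. cmod (f x) \<le> K"
    and h: "integrable lborel h" and cont: "continuous_on UNIV h" and hbd: "\<And>x. cmod (h x) \<le> L"
  shows "quadratic_form f h = (\<integral>x. \<phi> x * complex_of_real ((cmod (fourier_L1 h x))\<^sup>2) \<partial>lborel)"
proof -
  let ?A = "autocorrelation h" and ?B = "\<lambda>x. complex_of_real ((cmod (fourier_L1 h x))\<^sup>2)"
  obtain k where k: "\<And>n. k n \<in> L1 lborel \<inter> L2 lborel"
    and kf: "(\<lambda>n. L2_dist lborel (k n) f) \<longlonglongrightarrow> 0"
    and k\<phi>: "(\<lambda>n. L2_dist lborel (fourier_L1 (k n)) \<phi>) \<longlonglongrightarrow> 0"
    and f: "f \<in> L2 lborel" and \<phi>2: "\<phi> \<in> L2 lborel"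
    using \<phi> unfolding has_fourier_L2_def by blast
  have h2: "h \<in> L2 lborel" by (rule L2_of_bounded[OF h hbd])
  have A: "integrable lborel ?A" by (rule integrable_autocorrelation[OF h])
  have A2: "?A \<in> L2 lborel"
    by (rule L2_of_bounded[OF A], rule norm_autocorrelation_le) (use h2 in \<open>auto simp: L2_def\<close>)
  have FA: "fourier_L1 ?A = ?B" using fourier_autocorrelation[OF h] by auto
  have B: "integrable lborel ?B"
    using bessel_fourier_L1[OF h L2D(2)[OF h2]] by (simp only: complex_of_real_integrable_eq)
  have B2: "?B \<in> L2 lborel"
    by (rule L2_of_bounded[OF B, where K = "(\<integral>x. cmod (h x) \<partial>lborel)\<^sup>2"])
       (auto intro!: power_mono norm_fourier_L1_le simp: norm_power)
  have inv: "fourier_L1 ?B t = ?A (- t)" for t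
    using fourier_inversion[OF A continuous_on_autocorrelation[OF h cont hbd]
        norm_autocorrelation_le[OF L2D(1)[OF h2] L2D(2)[OF h2]]] B
    by (simp add: FA)
  have A2': "(\<lambda>t. ?A (- t)) \<in> L2 lborel"
  proof -
    have "(\<lambda>t. ?A (0 - t)) \<in> borel_measurable lborel"
      using L2D(1)[OF A2] by measurable
    then show ?thesis
      using L2D(2)[OF A2] integrable_lborel_reflect[of "\<lambda>t. (cmod (?A t))\<^sup>2" 0]
      by (simp add: L2_def)
  qed
  have "(\<lambda>n. \<integral>x. fourier_L1 (k n) x * ?B x \<partial>lborel) \<longlonglongrightarrow> (\<integral>x. \<phi> x * ?B x \<partial>lborel)"
    by (rule tendsto_integral_L2_mult[OF _ \<phi>2 B2 k\<phi>]) (rule fourier_L1_in_L2[OF k])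
  moreover have "(\<integral>x. fourier_L1 (k n) x * ?B x \<partial>lborel) = (\<integral>t. k n t * ?A (- t) \<partial>lborel)" for n
    unfolding inv[symmetric] using k[of n] by (intro fourier_multiplication B) (simp add: L1_def)
  moreover have "(\<lambda>n. \<integral>t. k n t * ?A (- t) \<partial>lborel) \<longlonglongrightarrow> (\<integral>t. f t * ?A (- t) \<partial>lborel)"
    using k by (intro tendsto_integral_L2_mult[OF _ f A2' kf]) auto
  ultimately show ?thesis
    using LIMSEQ_unique quadratic_form_autocorrelation[OF L2D(1)[OF f] bd h] by simp
qed

section \<open>Bounding a function by its Gaussian averages\<close>

text \<open>
  The functions \<open>max 0 (1 - n dist (x, S))\<close> do this; the empty set is treated separately because
  \<open>infdist x {} = 0\<close>.
\<close>

lemma cutoff_functions: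
  fixes S :: "'a::euclidean_space set"
  assumes S: "compact S"
  shows "\<exists>(u :: nat \<Rightarrow> 'a \<Rightarrow> real) R. (\<forall>n. continuous_on UNIV (u n)) \<and>
    (\<forall>n x. 0 \<le> u n x \<and> u n x \<le> indicator (cball 0 R) x) \<and> (\<forall>x. (\<lambda>n. u n x) \<longlonglongrightarrow> indicator S x)"
proof (cases "S = {}")
  case True
  then show ?thesis by (intro exI[of _ "\<lambda>_ _. 0"]) auto
next
  case False
  obtain r where r: "\<And>x. x \<in> S \<Longrightarrow> norm x \<le> r"
    using compact_imp_bounded[OF S] by (auto simp: bounded_iff)
  define u where "u n x = max 0 (1 - real (Suc n) * infdist x S)" for n x
  have u1: "u n x \<le> 1" for n x
    by (simp add: u_def infdist_nonneg)
  have supp: "u n x = 0" if "x \<notin> cball 0 (r + 1)" for n x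
  proof -
    obtain y where y: "y \<in> S" "infdist x S = dist x y"
      using infdist_attains_inf[OF compact_imp_closed[OF S] False] by blast
    have "norm x \<le> dist x y + norm y"
      using norm_triangle_ineq[of "x - y" y] by (simp add: dist_norm)
    then have "infdist x S \<ge> 1" using that r[OF y(1)] y(2) by simp
    then have "1 \<le> real (Suc n) * infdist x S"
      using mult_mono[of 1 "real (Suc n)" 1 "infdist x S"] by simp
    then show ?thesis by (simp add: u_def)
  qed
  show ?thesis
  proof (rule exI[of _ u], rule exI[of _ "r + 1"], intro conjI allI)
    show "continuous_on UNIV (u n)" for n
      unfolding u_def by (intro continuous_intros)
    show "(\<lambda>n. u n x) \<longlonglongrightarrow> indicator S x" for x
    proof (cases "x \<in> S")
      case True then show ?thesis by (simp add: u_def)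
    next
      case x: False
      then have d: "infdist x S > 0"
        using in_closed_iff_infdist_zero[OF compact_imp_closed[OF S] False] infdist_nonneg[of x S]
        by (metis less_eq_real_def)
      obtain N where N: "1 / infdist x S < real N" using reals_Archimedean2 by blast
      have "u n x = 0" if "n \<ge> N" for n
      proof -
        have "1 / infdist x S \<le> real (Suc n)" using N that by simp
        then have "1 \<le> real (Suc n) * infdist x S" using d by (simp add: pos_divide_le_eq)
        then show ?thesis by (simp add: u_def)
      qed
      then have "\<forall>\<^sub>F n in sequentially. u n x = 0" by (auto simp: eventually_sequentially)
      then show ?thesis using x by (simp add: tendsto_eventually)
    qed
    show "0 \<le> u n x" for n x by (simp add: u_def)
    show "u n x \<le> indicator (cball 0 (r + 1)) x" for n x
      using u1[of n x] supp[of x n] by (cases "x \<in> cball 0 (r + 1)") auto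
  qed
qed

lemma integrable_indicator_cball: "integrable lborel (\<lambda>x::'a::euclidean_space. indicator (cball 0 R) x :: real)"
  using emeasure_lborel_cball_finite[of "0::'a" R] by (intro integrable_real_indicator) auto

lemma integrable_locally_of_square:
  fixes \<psi> :: "'a::euclidean_space \<Rightarrow> real"
  assumes [measurable]: "\<psi> \<in> borel_measurable lborel" and \<psi>2: "integrable lborel (\<lambda>x. (\<psi> x)\<^sup>2)"
  shows "integrable lborel (\<lambda>x. indicator (cball 0 R) x * \<psi> x)"
proof (rule Bochner_Integration.integrable_bound)
  show "integrable lborel (\<lambda>x. (indicator (cball 0 R) x + (\<psi> x)\<^sup>2) / 2)"
    using integrable_indicator_cball[of R, where 'a='a] \<psi>2 by simp
  show "AE x in lborel. norm (indicator (cball 0 R) x * \<psi> x) \<le> norm ((indicator (cball 0 R) x + (\<psi> x)\<^sup>2) / 2)"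
  proof (intro AE_I2)
    fix x
    have "\<bar>\<psi> x\<bar> * 2 \<le> 1 + (\<psi> x)\<^sup>2" using sum_squares_bound[of 1 "\<bar>\<psi> x\<bar>"] by simp
    then show "norm (indicator (cball 0 R) x * \<psi> x) \<le> norm ((indicator (cball 0 R) x + (\<psi> x)\<^sup>2) / 2)"
      by (auto simp: indicator_def abs_mult)
  qed
qed (intro borel_measurable_times borel_measurable_indicator assms(1), simp)

text \<open>
  Integrate the assumption against \<open>u\<close>. Moving the translation from \<open>\<psi>\<close> to \<open>u\<close>, the left-hand side
  becomes the Gaussian average of \<open>P (s z)\<close>, where \<open>P t = \<integral> u (a - t) \<psi> a da\<close> is bounded
  and continuous at 0 because \<open>u\<close> is continuous with bounded support. Now let \<open>s \<longlonglongrightarrow> 0\<close>.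
\<close>

lemma gaussian_averages_test:
  fixes \<psi> u :: "'a::euclidean_space \<Rightarrow> real"
  assumes \<psi>m[measurable]: "\<psi> \<in> borel_measurable lborel" and \<psi>2: "integrable lborel (\<lambda>x. (\<psi> x)\<^sup>2)"
    and avg: "\<And>a s. s > 0 \<Longrightarrow> (\<integral>z. \<psi> (a + s *\<^sub>R z) * gauss z \<partial>lborel) \<le> c"
    and u: "continuous_on UNIV u" "\<And>x. 0 \<le> u x" "\<And>x. u x \<le> indicator (cball 0 R) x"
  shows "(\<integral>x. u x * \<psi> x \<partial>lborel) \<le> c * (\<integral>x. u x \<partial>lborel)"
proof -
  have um[measurable]: "u \<in> borel_measurable borel"
    by (intro borel_measurable_continuous_onI u)
  have uI: "u x \<le> 1" for x
    using u(3)[of x] by (cases "x \<in> cball 0 R") auto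
  have u1: "integrable lborel u"
    by (rule Bochner_Integration.integrable_bound[OF integrable_indicator_cball[of R]])
       (use u(2,3) in auto)
  have u2: "integrable lborel (\<lambda>x. (u x)\<^sup>2)"
    by (rule Bochner_Integration.integrable_bound[OF u1])
       (use u(2) uI in \<open>auto simp: power2_eq_square mult_left_le\<close>)
  define D where "D = ((\<integral>x. (u x)\<^sup>2 \<partial>lborel) + (\<integral>x. (\<psi> x)\<^sup>2 \<partial>lborel)) / 2"
  have D0: "D \<ge> 0" by (simp add: D_def)
  have shift2: "integrable lborel (\<lambda>a. (\<psi> (a + t))\<^sup>2)" for t
    using integrable_lborel_shift[of "\<lambda>x. (\<psi> x)\<^sup>2" t] \<psi>2 by simp
  have le2: "\<bar>u a * \<psi> (a + t)\<bar> \<le> ((u a)\<^sup>2 + (\<psi> (a + t))\<^sup>2) / 2" for a t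
    using sum_squares_bound[of "\<bar>u a\<bar>" "\<bar>\<psi> (a + t)\<bar>"] by (simp add: abs_mult)
  have i1: "integrable lborel (\<lambda>a. u a * \<psi> (a + t))" for t
  proof (rule Bochner_Integration.integrable_bound)
    show "integrable lborel (\<lambda>a. ((u a)\<^sup>2 + (\<psi> (a + t))\<^sup>2) / 2)" using u2 shift2 by simp
    show "AE a in lborel. norm (u a * \<psi> (a + t)) \<le> norm (((u a)\<^sup>2 + (\<psi> (a + t))\<^sup>2) / 2)"
      unfolding real_norm_def by (intro AE_I2 order_trans[OF le2 abs_ge_self])
  qed measurable
  have D: "(\<integral>a. \<bar>u a * \<psi> (a + t)\<bar> \<partial>lborel) \<le> D" for t
  proof -
    have "(\<integral>a. \<bar>u a * \<psi> (a + t)\<bar> \<partial>lborel) \<le> (\<integral>a. ((u a)\<^sup>2 + (\<psi> (a + t))\<^sup>2) / 2 \<partial>lborel)"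
      using i1 u2 shift2 by (intro integral_mono le2) auto
    also have "\<dots> = D"
      using u2 shift2 integral_lborel_shift[of "\<lambda>x. (\<psi> x)\<^sup>2" t] by (simp add: D_def)
    finally show ?thesis .
  qed
  define P where "P t = (\<integral>a. u a * \<psi> (a + t) \<partial>lborel)" for t
  have PD: "\<bar>P t\<bar> \<le> D" for t
    unfolding P_def using integral_abs_bound[of lborel "\<lambda>a. u a * \<psi> (a + t)"] D[of t] by linarith
  have P_shift: "P t = (\<integral>a. u (a - t) * \<psi> a \<partial>lborel)" for t
    unfolding P_def using integral_lborel_shift[of "\<lambda>a. u (a - t) * \<psi> a" t] by simp
  define s where "s n = 1 / real (Suc n)" for n
  have s: "s n > 0" "s n \<le> 1" for n by (simp_all add: s_def)
  have s0: "s \<longlonglongrightarrow> 0" unfolding s_def by (rule LIMSEQ_inverse_real_of_nat[unfolded inverse_eq_divide])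
  have [measurable]: "P \<in> borel_measurable borel"
    unfolding P_def by measurable
  have J: "(\<integral>z. P (s n *\<^sub>R z) * gauss z \<partial>lborel) \<le> c * (\<integral>x. u x \<partial>lborel)" for n
  proof -
    let ?F = "\<lambda>z a. u a * \<psi> (a + s n *\<^sub>R z) * gauss z"
    have F: "integrable (lborel \<Otimes>\<^sub>M lborel) (\<lambda>(z, a). ?F z a)"
    proof (rule integrable_lborel_pairI)
      show "(\<lambda>(z, a). ?F z a) \<in> borel_measurable (borel \<Otimes>\<^sub>M borel)" by measurable
      show "integrable lborel (?F z)" for z using i1[of "s n *\<^sub>R z"] by simp
      show "(\<integral>a. norm (?F z a) \<partial>lborel) \<le> D * gauss z" for z
        using mult_right_mono[OF D[of "s n *\<^sub>R z"] gauss_nonneg[of z]] by (simp add: abs_mult)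
      show "integrable lborel (\<lambda>z::'a. D * gauss z)" using integrable_gauss[where 'a='a] by simp
    qed
    have "(\<integral>z. P (s n *\<^sub>R z) * gauss z \<partial>lborel) = (\<integral>z. \<integral>a. ?F z a \<partial>lborel \<partial>lborel)"
      by (simp add: P_def)
    also have "\<dots> = (\<integral>a. \<integral>z. ?F z a \<partial>lborel \<partial>lborel)"
      by (rule lborel_pair.Fubini_integral[OF F, symmetric])
    also have "\<dots> \<le> (\<integral>a. u a * c \<partial>lborel)"
    proof (rule integral_mono)
      show "integrable lborel (\<lambda>a. \<integral>z. ?F z a \<partial>lborel)"
        using lborel_pair.integrable_snd[OF F] by simp
      show "integrable lborel (\<lambda>a. u a * c)" using u1 by simp
      fix a
      have "(\<integral>z. ?F z a \<partial>lborel) = u a * (\<integral>z. \<psi> (a + s n *\<^sub>R z) * gauss z \<partial>lborel)"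
        by (simp add: mult.assoc)
      also have "\<dots> \<le> u a * c" by (intro mult_left_mono avg s u)
      finally show "(\<integral>z. ?F z a \<partial>lborel) \<le> u a * c" .
    qed
    finally show ?thesis by (simp add: mult.commute)
  qed
  have Plim: "(\<lambda>n. P (s n *\<^sub>R z)) \<longlonglongrightarrow> P 0" for z
    unfolding P_shift
  proof (rule integral_dominated_convergence[where w = "\<lambda>a. \<bar>indicator (cball 0 (R + norm z)) a * \<psi> a\<bar>"])
    show "AE a in lborel. (\<lambda>n. u (a - s n *\<^sub>R z) * \<psi> a) \<longlonglongrightarrow> u (a - 0) * \<psi> a"
    proof (intro AE_I2 tendsto_mult tendsto_const)
      fix a
      have c: "continuous_on UNIV (\<lambda>r. u (a - r *\<^sub>R z))"
        by (intro continuous_on_compose2[OF u(1)] continuous_intros) auto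
      show "(\<lambda>n. u (a - s n *\<^sub>R z)) \<longlonglongrightarrow> u (a - 0)"
        using continuous_on_tendsto_compose[OF c s0] by simp
    qed
    show "AE a in lborel. norm (u (a - s n *\<^sub>R z) * \<psi> a) \<le> \<bar>indicator (cball 0 (R + norm z)) a * \<psi> a\<bar>" for n
    proof (intro AE_I2)
      fix a
      have "u (a - s n *\<^sub>R z) \<le> indicator (cball 0 (R + norm z)) a"
      proof (cases "a \<in> cball 0 (R + norm z)")
        case False
        have "norm (s n *\<^sub>R z) \<le> norm z" using s[of n] by (simp add: mult_left_le_one_le)
        then have "a - s n *\<^sub>R z \<notin> cball 0 R"
          using False norm_triangle_ineq2[of a "s n *\<^sub>R z"] by simp
        then show ?thesis using u(3)[of "a - s n *\<^sub>R z"] by (simp add: indicator_def)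
      qed (use uI in simp)
      then show "norm (u (a - s n *\<^sub>R z) * \<psi> a) \<le> \<bar>indicator (cball 0 (R + norm z)) a * \<psi> a\<bar>"
        unfolding real_norm_def abs_mult using u(2) by (intro mult_right_mono) auto
    qed
    show "integrable lborel (\<lambda>a. \<bar>indicator (cball 0 (R + norm z)) a * \<psi> a\<bar>)"
      by (rule integrable_abs[OF integrable_locally_of_square[OF \<psi>m \<psi>2]])
  qed measurable
  have "(\<lambda>n. \<integral>z. P (s n *\<^sub>R z) * gauss z \<partial>lborel) \<longlonglongrightarrow> (\<integral>z. P 0 * gauss (z::'a) \<partial>lborel)"
  proof (rule integral_dominated_convergence[where w = "\<lambda>z. D * gauss z"])
    show "AE z in lborel. (\<lambda>n. P (s n *\<^sub>R z) * gauss z) \<longlonglongrightarrow> P 0 * gauss z"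
      by (intro AE_I2 tendsto_mult tendsto_const Plim)
    show "AE z in lborel. norm (P (s n *\<^sub>R z) * gauss z) \<le> D * gauss z" for n
      by (intro AE_I2) (auto simp: abs_mult intro!: mult_right_mono PD)
  qed (use integrable_gauss[where 'a='a] in auto)
  moreover have "(\<integral>z. P 0 * gauss (z::'a) \<partial>lborel) = (\<integral>x. u x * \<psi> x \<partial>lborel)"
    by (simp add: integral_gauss P_def)
  ultimately show ?thesis
    using J by (intro LIMSEQ_le_const2[of _ "\<integral>x. u x * \<psi> x \<partial>lborel"]) auto
qed

text \<open>
  A compact subset of \<open>{x. \<psi> x > c}\<close> must be null, and a Borel set of finite measure all of
  whose compact subsets are null is itself null by inner regularity.
\<close>

lemma AE_le_of_compact_integrals:
  fixes \<psi> :: "'a::euclidean_space \<Rightarrow> real"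
  assumes [measurable]: "\<psi> \<in> borel_measurable lborel"
    and int: "\<And>S. compact S \<Longrightarrow> integrable lborel (\<lambda>x. indicator S x * \<psi> x)"
    and le: "\<And>S. compact S \<Longrightarrow> (\<integral>x. indicator S x * \<psi> x \<partial>lborel) \<le> c * measure lborel S"
  shows "AE x in lborel. \<psi> x \<le> c"
proof -
  let ?E = "{x. \<psi> x > c}"
  have E[measurable]: "?E \<in> sets borel" by measurable
  have null: "emeasure lborel S = 0" if S: "compact S" "S \<subseteq> ?E" for S
  proof -
    have [measurable]: "S \<in> sets borel" using S(1) by (intro borel_compact)
    have iS: "integrable lborel (\<lambda>x. indicator S x :: real)"
      using emeasure_compact_finite[OF S(1)] by (intro integrable_real_indicator) auto
    let ?f = "\<lambda>x. indicator S x * (\<psi> x - c)"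
    have f: "integrable lborel ?f"
      using int[OF S(1)] iS by (simp add: right_diff_distrib)
    have pos: "?f x \<ge> 0" for x using S(2) by (auto simp: indicator_def)
    have "(\<integral>x. ?f x \<partial>lborel) = (\<integral>x. indicator S x * \<psi> x \<partial>lborel) - measure lborel S * c"
      using int[OF S(1)] iS by (simp add: right_diff_distrib)
    moreover have "(\<integral>x. ?f x \<partial>lborel) \<ge> 0"
      using pos by (rule Bochner_Integration.integral_nonneg)
    ultimately have "(\<integral>x. ?f x \<partial>lborel) = 0"
      using le[OF S(1)] by (simp add: mult.commute)
    then have "AE x in lborel. ?f x = 0"
      using integral_nonneg_eq_0_iff_AE[OF f] pos by simp
    then have "AE x in lborel. x \<notin> S"
      by eventually_elim (use S(2) in \<open>auto simp: indicator_def split: if_splits\<close>)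
    then show ?thesis by (subst (asm) AE_iff_measurable[OF _ refl]) auto
  qed
  have nullE: "emeasure lborel (?E \<inter> cball 0 (real n)) = 0" for n
  proof -
    let ?B = "cball (0::'a) (real n)"
    let ?M = "density lborel (indicator ?B)"
    have "emeasure ?M (space ?M) \<noteq> \<infinity>"
      using emeasure_lborel_cball_finite[of "0::'a" "real n"] by (simp add: emeasure_restricted less_top)
    then have "emeasure ?M ?E = (SUP K \<in> {K. K \<subseteq> ?E \<and> compact K}. emeasure ?M K)"
      by (intro inner_regular) auto
    also have "\<dots> \<le> 0"
    proof (rule SUP_least)
      fix K assume K: "K \<in> {K. K \<subseteq> ?E \<and> compact K}"
      then have [measurable]: "K \<in> sets borel" by (intro borel_compact) auto
      have "emeasure ?M K = emeasure lborel (?B \<inter> K)"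
        by (simp add: emeasure_restricted)
      also have "\<dots> \<le> emeasure lborel K" by (intro emeasure_mono) auto
      finally show "emeasure ?M K \<le> 0" using null[of K] K by auto
    qed
    also have "emeasure ?M ?E = emeasure lborel (?B \<inter> ?E)"
      by (simp add: emeasure_restricted)
    finally show ?thesis by (simp add: Int_commute)
  qed
  have "(\<Union>n. ?E \<inter> cball 0 (real n)) \<in> null_sets lborel"
    using nullE by (intro null_sets_UN) (auto simp: null_sets_def)
  moreover have "{x \<in> space lborel. \<not> \<psi> x \<le> c} \<subseteq> (\<Union>n. ?E \<inter> cball 0 (real n))"
  proof
    fix x assume "x \<in> {x \<in> space lborel. \<not> \<psi> x \<le> c}"
    moreover obtain n where "norm x \<le> real n" using real_arch_simple by blast
    ultimately show "x \<in> (\<Union>n. ?E \<inter> cball 0 (real n))" by auto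
  qed
  ultimately show ?thesis by (rule AE_I')
qed

theorem AE_le_of_gaussian_averages:
  fixes \<psi> :: "'a::euclidean_space \<Rightarrow> real"
  assumes \<psi>m[measurable]: "\<psi> \<in> borel_measurable lborel" and \<psi>2: "integrable lborel (\<lambda>x. (\<psi> x)\<^sup>2)"
    and avg: "\<And>a s. s > 0 \<Longrightarrow> (\<integral>z. \<psi> (a + s *\<^sub>R z) * gauss z \<partial>lborel) \<le> c"
  shows "AE x in lborel. \<psi> x \<le> c"
proof (rule AE_le_of_compact_integrals)
  fix S :: "'a set" assume S: "compact S"
  obtain u :: "nat \<Rightarrow> 'a \<Rightarrow> real" and R where u: "\<And>n. continuous_on UNIV (u n)" "\<And>n x. 0 \<le> u n x"
    "\<And>n x. u n x \<le> indicator (cball 0 R) x" "\<And>x. (\<lambda>n. u n x) \<longlonglongrightarrow> indicator S x"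
    using cutoff_functions[OF S] by blast
  have [measurable]: "u n \<in> borel_measurable borel" for n
    by (intro borel_measurable_continuous_onI u)
  have [measurable]: "S \<in> sets borel" using S by (intro borel_compact)
  let ?w = "\<lambda>x. \<bar>indicator (cball 0 R) x * \<psi> x\<bar>"
  have w: "integrable lborel ?w"
    by (rule integrable_abs[OF integrable_locally_of_square[OF \<psi>m \<psi>2]])
  have lim: "AE x in lborel. (\<lambda>n. u n x * \<psi> x) \<longlonglongrightarrow> indicator S x * \<psi> x"
    by (intro AE_I2 tendsto_mult tendsto_const u)
  have bd: "AE x in lborel. norm (u n x * \<psi> x) \<le> ?w x" for n
    unfolding real_norm_def abs_mult using u(2,3) by (intro AE_I2 mult_right_mono) auto
  show "integrable lborel (\<lambda>x. indicator S x * \<psi> x)"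
    by (rule integrable_dominated_convergence[OF _ _ w lim bd]) measurable
  have "(\<lambda>n. \<integral>x. u n x * \<psi> x \<partial>lborel) \<longlonglongrightarrow> (\<integral>x. indicator S x * \<psi> x \<partial>lborel)"
    by (rule integral_dominated_convergence[OF _ _ w lim bd]) measurable
  moreover have "(\<lambda>n. c * (\<integral>x. u n x \<partial>lborel)) \<longlonglongrightarrow> c * (\<integral>x. indicator S x \<partial>lborel)"
    by (intro tendsto_mult tendsto_const
          integral_dominated_convergence[OF _ _ integrable_indicator_cball[of R]])
       (use u in auto)
  ultimately have "(\<integral>x. indicator S x * \<psi> x \<partial>lborel) \<le> c * (\<integral>x. indicator S x \<partial>lborel)"
    using gaussian_averages_test[OF \<psi>m \<psi>2 avg u(1-3)] by (intro LIMSEQ_le) auto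
  then show "(\<integral>x. indicator S x * \<psi> x \<partial>lborel) \<le> c * measure lborel S"
    by simp
qed measurable

section \<open>The spectral density and the quadratic form\<close>

text \<open>
  The Fourier transform of this packet is concentrated near \<open>a\<close>. With the factor
  \<open>sqrt 2\<close>, the squared modulus of that transform is a multiple of \<open>gauss ((x - a) / s)\<close>.
\<close>

definition wave_packet :: "'a::euclidean_space \<Rightarrow> real \<Rightarrow> 'a \<Rightarrow> complex" where
  "wave_packet a s x = complex_of_real (gauss ((sqrt 2 * s) *\<^sub>R x)) * cnj (wave a x)"

lemma integrable_wave_packet:
  assumes "s > 0"
  shows "integrable lborel (wave_packet (a::'a::euclidean_space) s)"
proof (rule Bochner_Integration.integrable_bound)
  show "integrable lborel (\<lambda>x::'a. gauss ((sqrt 2 * s) *\<^sub>R x))"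
    using assms by (intro integrable_gauss_scaled) simp
  show "wave_packet a s \<in> borel_measurable lborel"
    unfolding wave_packet_def by measurable
qed (simp add: wave_packet_def norm_mult)

lemma continuous_on_wave_packet: "continuous_on UNIV (wave_packet a s)"
  unfolding wave_packet_def by (intro continuous_intros)

lemma norm_wave_packet_le_1: "cmod (wave_packet a s x) \<le> 1"
  by (simp add: wave_packet_def norm_mult)

lemma integral_wave_packet_square:
  assumes s: "s > 0"
  shows "(\<integral>x. (cmod (wave_packet (a::'a::euclidean_space) s x))\<^sup>2 \<partial>lborel) = 1 / (2 * s) ^ DIM('a)"
proof -
  have e: "sqrt 2 * (sqrt 2 * s) = 2 * s" by (simp flip: mult.assoc)
  then show ?thesis
    using integral_gauss_scaled[of "2 * s", where 'a='a] s
    by (simp add: wave_packet_def norm_mult gauss_square e)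
qed

lemma fourier_wave_packet:
  fixes a :: "'a::euclidean_space"
  assumes s: "s > 0"
  shows "fourier_L1 (wave_packet a s) x = gauss ((x - a) /\<^sub>R (sqrt 2 * s)) / (sqrt 2 * s) ^ DIM('a)"
proof -
  have w: "wave (x - a) y = wave x y * cnj (wave a y)" for y
    by (simp only: wave_commute[of _ y] wave_diff)
  have "fourier_L1 (wave_packet a s) x = fourier_L1 (\<lambda>y. complex_of_real (gauss ((sqrt 2 * s) *\<^sub>R y))) (x - a)"
    unfolding fourier_L1_wave wave_packet_def w by (simp add: mult_ac)
  then show ?thesis using s by (simp add: fourier_gauss_scaled)
qed

lemma quadratic_form_wave_packet:
  fixes a :: "'a::euclidean_space"
  assumes \<phi>: "has_fourier_L2 f \<phi>" and bd: "\<And>x. cmod (f x) \<le> K" and s: "s > 0"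
  shows "quadratic_form f (wave_packet a s) =
    complex_of_real (1 / (2 * s) ^ DIM('a)) * (\<integral>z. \<phi> (a + s *\<^sub>R z) * complex_of_real (gauss z) \<partial>lborel)"
proof -
  have g: "(gauss ((s *\<^sub>R z) /\<^sub>R (sqrt 2 * s)))\<^sup>2 = gauss z" for z :: 'a
  proof -
    have "sqrt 2 * (inverse (sqrt 2 * s) * s) = 1" using s by (simp add: field_simps)
    then have "sqrt 2 *\<^sub>R ((s *\<^sub>R z) /\<^sub>R (sqrt 2 * s)) = z" by (simp only: scaleR_scaleR scaleR_one mult.assoc)
    then show ?thesis by (simp only: gauss_square)
  qed
  have c: "s ^ DIM('a) / ((sqrt 2 * s) ^ DIM('a))\<^sup>2 = 1 / (2 * s) ^ DIM('a)"
  proof -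
    have "((sqrt 2 * s) ^ DIM('a))\<^sup>2 = ((sqrt 2 * s)\<^sup>2) ^ DIM('a)"
      by (simp only: power_mult[symmetric] mult.commute)
    also have "(sqrt 2 * s)\<^sup>2 = (2 * s) * s"
      by (simp add: power_mult_distrib power2_eq_square)
    also have "\<dots> ^ DIM('a) = (2 * s) ^ DIM('a) * s ^ DIM('a)"
      by (rule power_mult_distrib)
    finally show ?thesis using s by simp
  qed
  have "quadratic_form f (wave_packet a s) =
      (\<integral>x. \<phi> x * complex_of_real ((cmod (fourier_L1 (wave_packet a s) x))\<^sup>2) \<partial>lborel)"
    by (rule quadratic_form_spectral[OF \<phi> bd integrable_wave_packet[OF s]
          continuous_on_wave_packet norm_wave_packet_le_1])
  also have "\<dots> = (\<integral>x. \<phi> x * complex_of_real ((gauss ((x - a) /\<^sub>R (sqrt 2 * s)))\<^sup>2 / ((sqrt 2 * s) ^ DIM('a))\<^sup>2) \<partial>lborel)"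
    unfolding fourier_wave_packet[OF s] norm_of_real power2_abs power_divide ..
  also have "\<dots> = (\<bar>s\<bar> ^ DIM('a)) *\<^sub>R (\<integral>z. \<phi> (a + s *\<^sub>R z) *
      complex_of_real (gauss z / ((sqrt 2 * s) ^ DIM('a))\<^sup>2) \<partial>lborel)"
    by (subst integral_lborel_affine[of s _ a])
       (use s in \<open>simp_all only: add_diff_cancel_left' g less_imp_neq[symmetric] not_False_eq_True\<close>)
  also have "\<dots> = complex_of_real (s ^ DIM('a) / ((sqrt 2 * s) ^ DIM('a))\<^sup>2) *
      (\<integral>z. \<phi> (a + s *\<^sub>R z) * complex_of_real (gauss z) \<partial>lborel)"
    using s by (simp add: scaleR_conv_of_real)
  finally show ?thesis unfolding c .
qed

text \<open>
  Integrability makes the Fourier transform a convergent integral; continuity and boundedness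
  make the autocorrelation continuous, as inversion requires.
\<close>

definition test_function :: "('a::euclidean_space \<Rightarrow> complex) \<Rightarrow> bool" where
  "test_function h \<longleftrightarrow> integrable lborel h \<and> continuous_on UNIV h \<and> (\<exists>L. \<forall>x. cmod (h x) \<le> L)"

text \<open>
  From left to right this is Bessel's inequality. From right to left, wave packets bound the
  Gaussian averages of \<open>Re \<phi>\<close> by 1 and those of \<open>\<plusminus> Im \<phi>\<close> by 0.
\<close>

theorem spectral_density_le_1_iff:
  fixes f :: "'a::euclidean_space \<Rightarrow> complex"
  assumes \<phi>: "has_fourier_L2 f \<phi>" and bd: "\<And>x. cmod (f x) \<le> K"
  shows "(AE x in lborel. \<phi> x \<le> 1) \<longleftrightarrow>
    (\<forall>h. test_function h \<longrightarrow> quadratic_form f h \<le> complex_of_real (\<integral>x. (cmod (h x))\<^sup>2 \<partial>lborel))"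
proof safe
  have \<phi>2: "\<phi> \<in> L2 lborel" using \<phi> by (simp add: has_fourier_L2_def)
  note [measurable] = L2D(1)[OF \<phi>2]
  {
    fix h :: "'a \<Rightarrow> complex"
    assume le: "AE x in lborel. \<phi> x \<le> 1" and "test_function h"
    then obtain L where h: "integrable lborel h" "continuous_on UNIV h" "\<And>x. cmod (h x) \<le> L"
      by (auto simp: test_function_def)
    have h2: "h \<in> L2 lborel" by (rule L2_of_bounded[OF h(1,3)])
    define B where "B x = (cmod (fourier_L1 h x))\<^sup>2" for x
    have B: "integrable lborel B" "(\<integral>x. B x \<partial>lborel) \<le> (\<integral>x. (cmod (h x))\<^sup>2 \<partial>lborel)"
      using bessel_fourier_L1[OF h(1) L2D(2)[OF h2]] by (auto simp: B_def[abs_def])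
    have B2: "(\<lambda>x. complex_of_real (B x)) \<in> L2 lborel"
    proof (rule L2_of_bounded[where K = "(\<integral>x. cmod (h x) \<partial>lborel)\<^sup>2"])
      show "integrable lborel (\<lambda>x. complex_of_real (B x))" using B(1) by simp
      show "cmod (complex_of_real (B x)) \<le> (\<integral>x. cmod (h x) \<partial>lborel)\<^sup>2" for x
        by (auto intro!: power_mono norm_fourier_L1_le simp: B_def norm_power)
    qed
    have int: "integrable lborel (\<lambda>x. \<phi> x * complex_of_real (B x))"
      by (rule L2_mult[OF \<phi>2 B2])
    have q: "quadratic_form f h = (\<integral>x. \<phi> x * complex_of_real (B x) \<partial>lborel)"
      unfolding B_def by (rule quadratic_form_spectral[OF \<phi> bd h])
    have "Re (quadratic_form f h) = (\<integral>x. Re (\<phi> x) * B x \<partial>lborel)"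
      unfolding q using integral_Re[OF int] by simp
    also have "\<dots> \<le> (\<integral>x. B x \<partial>lborel)"
    proof (rule integral_mono_AE)
      show "integrable lborel (\<lambda>x. Re (\<phi> x) * B x)" using integrable_Re[OF int] by simp
      show "AE x in lborel. Re (\<phi> x) * B x \<le> B x"
        using le
      proof eventually_elim
        fix x assume "\<phi> x \<le> 1"
        then show "Re (\<phi> x) * B x \<le> B x"
          using mult_right_mono[of "Re (\<phi> x)" 1 "B x"] by (simp add: less_eq_complex_def B_def)
      qed
    qed (rule B)
    finally have "Re (quadratic_form f h) \<le> (\<integral>x. (cmod (h x))\<^sup>2 \<partial>lborel)" using B(2) by simp
    moreover have "Im (quadratic_form f h) = 0"
    proof -
      have "Im (quadratic_form f h) = (\<integral>x. Im (\<phi> x) * B x \<partial>lborel)"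
        unfolding q using integral_Im[OF int] by simp
      also have "\<dots> = 0"
        by (rule integral_eq_zero_AE) (use le in eventually_elim, simp add: less_eq_complex_def)
      finally show ?thesis .
    qed
    ultimately show "quadratic_form f h \<le> complex_of_real (\<integral>x. (cmod (h x))\<^sup>2 \<partial>lborel)"
      by (simp add: less_eq_complex_def)
  }
  assume le: "\<forall>h. test_function h \<longrightarrow> quadratic_form f h \<le> complex_of_real (\<integral>x. (cmod (h x))\<^sup>2 \<partial>lborel)"
  have cancel: "z \<le> 1" if "c > 0" "complex_of_real c * z \<le> complex_of_real c" for c z
    using that by (simp add: less_eq_complex_def)
  have avg: "(\<integral>z. \<phi> (a + s *\<^sub>R z) * complex_of_real (gauss z) \<partial>lborel) \<le> 1" if s: "s > 0" for a s
  proof -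
    have "test_function (wave_packet a s)"
      unfolding test_function_def
      using integrable_wave_packet[OF s] continuous_on_wave_packet norm_wave_packet_le_1 by blast
    with le have "quadratic_form f (wave_packet a s) \<le> complex_of_real (1 / (2 * s) ^ DIM('a))"
      unfolding integral_wave_packet_square[OF s, of a, symmetric] by blast
    then show ?thesis
      unfolding quadratic_form_wave_packet[OF \<phi> bd s] by (rule cancel[rotated]) (use s in simp)
  qed
  have int: "integrable lborel (\<lambda>z. \<phi> (a + s *\<^sub>R z) * complex_of_real (gauss z))" if s: "s > 0" for a s
  proof (rule L2_mult)
    show "(\<lambda>z. \<phi> (a + s *\<^sub>R z)) \<in> L2 lborel"
      using L2D(2)[OF \<phi>2] s integrable_lborel_affine[of "\<lambda>x. (cmod (\<phi> x))\<^sup>2" s a] by (simp add: L2_def)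
    show "(\<lambda>z::'a. complex_of_real (gauss z)) \<in> L2 lborel"
      by (rule L2_of_bounded[where K=1]) (auto intro: integrable_of_real integrable_gauss)
  qed
  have avgs: "(\<integral>z. Re (\<phi> (a + s *\<^sub>R z)) * gauss z \<partial>lborel) \<le> 1"
    "(\<integral>z. Im (\<phi> (a + s *\<^sub>R z)) * gauss z \<partial>lborel) = 0" if s: "s > 0" for a s
    using avg[OF s, of a] integral_Re[OF int[OF s, of a]] integral_Im[OF int[OF s, of a]]
    by (simp_all add: less_eq_complex_def)
  have sq: "integrable lborel (\<lambda>x. (Re (\<phi> x))\<^sup>2)" "integrable lborel (\<lambda>x. (Im (\<phi> x))\<^sup>2)"
    by (rule Bochner_Integration.integrable_bound[OF L2D(2)[OF \<phi>2]];
        auto intro!: AE_I2 simp: cmod_power2)+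
  have "AE x in lborel. Re (\<phi> x) \<le> 1"
    by (rule AE_le_of_gaussian_averages) (use avgs sq in auto)
  moreover have "AE x in lborel. Im (\<phi> x) \<le> 0"
    by (rule AE_le_of_gaussian_averages) (use avgs sq in auto)
  moreover have "AE x in lborel. - Im (\<phi> x) \<le> 0"
    by (rule AE_le_of_gaussian_averages) (use avgs sq in auto)
  ultimately show "AE x in lborel. \<phi> x \<le> 1"
    by eventually_elim (simp add: less_eq_complex_def)
qed

text \<open>
  Truncations to a ball and continuous cutoffs both converge in this way; it carries bounds on
  the form from one class of functions to another.
\<close>

lemma quadratic_form_dominated_convergence:
  fixes f :: "'a::euclidean_space \<Rightarrow> complex"
  assumes [measurable]: "f \<in> borel_measurable borel" and bd: "\<And>x. cmod (f x) \<le> K"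
    and h[measurable]: "\<And>n. h n \<in> borel_measurable borel" "h' \<in> borel_measurable borel"
    and lim: "\<And>x. (\<lambda>n. h n x) \<longlonglongrightarrow> h' x"
    and le: "\<And>n x. cmod (h n x) \<le> w x"
    and w: "integrable lborel w" and w2: "\<And>x. w x \<le> L"
  shows "(\<lambda>n. quadratic_form f (h n)) \<longlonglongrightarrow> quadratic_form f h'"
    and "(\<lambda>n. \<integral>x. (cmod (h n x))\<^sup>2 \<partial>lborel) \<longlonglongrightarrow> (\<integral>x. (cmod (h' x))\<^sup>2 \<partial>lborel)"
proof -
  have K: "K \<ge> 0" using bd[of 0] norm_ge_zero[of "f 0"] by linarith
  have w0: "w x \<ge> 0" for x using le[of 0 x] norm_ge_zero[of "h 0 x"] by linarith
  have inner: "(\<lambda>n. \<integral>y. f (x - y) * h n y \<partial>lborel) \<longlonglongrightarrow> (\<integral>y. f (x - y) * h' y \<partial>lborel)" for x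
  proof (rule integral_dominated_convergence[where w = "\<lambda>y. K * w y"])
    show "AE y in lborel. norm (f (x - y) * h n y) \<le> K * w y" for n
      unfolding norm_mult by (intro AE_I2 mult_mono bd le K) auto
  qed (use w lim in \<open>auto intro!: AE_I2 tendsto_intros\<close>)
  have inner_le: "cmod (\<integral>y. f (x - y) * h n y \<partial>lborel) \<le> K * (\<integral>y. w y \<partial>lborel)" for n x
  proof -
    have le': "cmod (f (x - y) * h n y) \<le> K * w y" for y
      unfolding norm_mult by (intro mult_mono bd le K) auto
    have Kw: "integrable lborel (\<lambda>y. K * w y)" using w by simp
    have int: "integrable lborel (\<lambda>y. f (x - y) * h n y)"
      by (rule Bochner_Integration.integrable_bound[OF Kw])
         (use order_trans[OF le' abs_ge_self] in \<open>auto simp del: norm_mult\<close>)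
    have "cmod (\<integral>y. f (x - y) * h n y \<partial>lborel) \<le> (\<integral>y. K * w y \<partial>lborel)"
      by (rule order_trans[OF integral_norm_bound integral_mono[OF integrable_norm[OF int] Kw le']])
    then show ?thesis by simp
  qed
  show "(\<lambda>n. quadratic_form f (h n)) \<longlonglongrightarrow> quadratic_form f h'"
    unfolding quadratic_form_def
  proof (rule integral_dominated_convergence[where w = "\<lambda>x. K * (\<integral>y. w y \<partial>lborel) * w x"])
    show "AE x in lborel. (\<lambda>n. (\<integral>y. f (x - y) * h n y \<partial>lborel) * cnj (h n x)) \<longlonglongrightarrow>
        (\<integral>y. f (x - y) * h' y \<partial>lborel) * cnj (h' x)"
      by (intro AE_I2 tendsto_intros inner lim)
    show "AE x in lborel. norm ((\<integral>y. f (x - y) * h n y \<partial>lborel) * cnj (h n x)) \<le> K * (\<integral>y. w y \<partial>lborel) * w x" for n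
      unfolding norm_mult complex_mod_cnj using K w0 by (intro AE_I2 mult_mono inner_le le) auto
  qed (use w in auto)
  show "(\<lambda>n. \<integral>x. (cmod (h n x))\<^sup>2 \<partial>lborel) \<longlonglongrightarrow> (\<integral>x. (cmod (h' x))\<^sup>2 \<partial>lborel)"
  proof (rule integral_dominated_convergence[where w = "\<lambda>x. L * w x"])
    show "AE x in lborel. norm ((cmod (h n x))\<^sup>2) \<le> L * w x" for n
    proof (intro AE_I2)
      fix x
      have "cmod (h n x) * cmod (h n x) \<le> L * w x"
        by (rule mult_mono[OF order_trans[OF le w2] le])
           (use order_trans[OF w0 w2] in auto)
      then show "norm ((cmod (h n x))\<^sup>2) \<le> L * w x" by (simp add: power2_eq_square)
    qed
    show "AE x in lborel. (\<lambda>n. (cmod (h n x))\<^sup>2) \<longlonglongrightarrow> (cmod (h' x))\<^sup>2"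
      by (intro AE_I2 tendsto_intros lim)
  qed (use w in auto)
qed

section \<open>Approximate eigenvectors of Hermitian kernels\<close>

definition L2_inner :: "'a measure \<Rightarrow> ('a \<Rightarrow> complex) \<Rightarrow> ('a \<Rightarrow> complex) \<Rightarrow> complex" where
  "L2_inner M f g = (\<integral>x. f x * cnj (g x) \<partial>M)"

definition L2_square :: "'a measure \<Rightarrow> ('a \<Rightarrow> complex) \<Rightarrow> real" where
  "L2_square M f = (\<integral>x. (cmod (f x))\<^sup>2 \<partial>M)"

lemma L2_square_nonneg: "L2_square M f \<ge> 0"
  by (simp add: L2_square_def)

lemma L2_inner_self: "L2_inner M f f = complex_of_real (L2_square M f)"
  unfolding L2_inner_def L2_square_def
  by (simp only: complex_norm_square[symmetric] integral_complex_of_real)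

lemma L2_inner_commute: "L2_inner M g f = cnj (L2_inner M f g)"
  unfolding L2_inner_def by (subst Bochner_Integration.integral_cnj[symmetric]) (simp add: mult.commute del: Bochner_Integration.integral_cnj)

lemma L2_inner_diff_left:
  assumes "A \<in> L2 M" "B \<in> L2 M" "f \<in> L2 M"
  shows "L2_inner M (\<lambda>x. A x - c * B x) f = L2_inner M A f - c * L2_inner M B f"
  using L2_mult[OF assms(1) L2_cnj[OF assms(3)]] L2_mult[OF assms(2) L2_cnj[OF assms(3)]]
  by (simp add: L2_inner_def left_diff_distrib mult.assoc)

lemma L2_inner_diff_right:
  assumes "A \<in> L2 M" "f \<in> L2 M" "r \<in> L2 M"
  shows "L2_inner M A (\<lambda>x. f x - c * r x) = L2_inner M A f - cnj c * L2_inner M A r"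
  using L2_inner_diff_left[OF assms(2,3,1), of c]
  by (subst L2_inner_commute, subst (2 3) L2_inner_commute) simp

lemma Re_L2_inner_expand:
  assumes "A \<in> L2 M" "B \<in> L2 M" "f \<in> L2 M" "r \<in> L2 M"
  shows "Re (L2_inner M (\<lambda>x. A x - complex_of_real s * B x) (\<lambda>x. f x - complex_of_real s * r x)) =
    Re (L2_inner M A f) - s * Re (L2_inner M A r) - s * Re (L2_inner M B f) + s\<^sup>2 * Re (L2_inner M B r)"
proof -
  have fr: "(\<lambda>x. f x - complex_of_real s * r x) \<in> L2 M"
    by (intro L2_diff L2_cmult assms)
  have eq: "L2_inner M (\<lambda>x. A x - complex_of_real s * B x) (\<lambda>x. f x - complex_of_real s * r x) =
      (L2_inner M A f - complex_of_real s * L2_inner M A r) -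
        complex_of_real s * (L2_inner M B f - complex_of_real s * L2_inner M B r)"
    by (simp only: L2_inner_diff_left[OF assms(1,2) fr] L2_inner_diff_right[OF assms(1,3,4)]
        L2_inner_diff_right[OF assms(2,3,4)] complex_cnj_complex_of_real)
  show ?thesis unfolding eq by (simp add: algebra_simps power2_eq_square)
qed

lemma L2_square_cmult: "L2_square M (\<lambda>x. c * f x) = (cmod c)\<^sup>2 * L2_square M f"
  by (simp add: L2_square_def norm_mult power_mult_distrib)

text \<open>
  Sections \<open>C x\<close> are taken at every point of the type, not only in \<open>space M\<close>, so that
  \<open>integral_operator M C f\<close> is meaningful everywhere. For an eigenfunction this supplies a
  representative that is defined outside the compact set.
\<close>

locale hermitian_kernel_operator = finite_measure M for M :: "'a measure" +
  fixes C :: "'a \<Rightarrow> 'a \<Rightarrow> complex" and K :: real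
  assumes kernel_measurable: "(\<lambda>(x, y). C x y) \<in> borel_measurable (M \<Otimes>\<^sub>M M)"
    and section_measurable: "\<And>x. C x \<in> borel_measurable M"
    and kernel_bound: "\<And>x y. cmod (C x y) \<le> K"
    and kernel_hermitian: "\<And>x y. C x y = cnj (C y x)"
begin

abbreviation T where "T \<equiv> integral_operator M C"

abbreviation mass where "mass \<equiv> measure M (space M)"

lemma K_nonneg: "K \<ge> 0"
  using kernel_bound[of undefined undefined] norm_ge_zero order_trans by blast

lemma integrable_of_L2:
  assumes f: "f \<in> L2 M"
  shows "integrable M f"
proof (rule Bochner_Integration.integrable_bound)
  show "integrable M (\<lambda>x. 1 + (cmod (f x))\<^sup>2)" using f by (simp add: L2D)
  have "cmod z \<le> 1 + (cmod z)\<^sup>2" for z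
  proof -
    have "2 * cmod z \<le> 1 + (cmod z)\<^sup>2" using sum_squares_bound[of 1 "cmod z"] by simp
    then show ?thesis using norm_ge_zero[of z] by linarith
  qed
  then show "AE x in M. norm (f x) \<le> norm (1 + (cmod (f x))\<^sup>2)"
    by (intro AE_I2) (simp add: order_trans[OF _ abs_ge_self])
qed (use f in \<open>simp add: L2D\<close>)

lemma integral_norm_le:
  assumes f: "f \<in> L2 M"
  shows "(\<integral>x. cmod (f x) \<partial>M)\<^sup>2 \<le> mass * L2_square M f"
  using Cauchy_Schwarz_L2[of f M "\<lambda>_. 1"] f by (simp add: L2_def L2_square_def mult.commute)

lemma integrable_kernel_mult:
  assumes f: "f \<in> L2 M"
  shows "integrable M (\<lambda>y. C x y * f y)"
proof (rule Bochner_Integration.integrable_bound)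
  show "integrable M (\<lambda>y. K * cmod (f y))" using integrable_of_L2[OF f] by simp
  show "AE y in M. norm (C x y * f y) \<le> norm (K * cmod (f y))"
    using K_nonneg by (intro AE_I2) (auto simp: norm_mult abs_mult intro!: mult_right_mono kernel_bound)
  show "(\<lambda>y. C x y * f y) \<in> borel_measurable M"
    using section_measurable L2D(1)[OF f] by (intro borel_measurable_times)
qed

lemma T_diff:
  assumes "f \<in> L2 M" "g \<in> L2 M"
  shows "T (\<lambda>x. f x - c * g x) x = T f x - c * T g x"
  using integrable_kernel_mult[OF assms(1), of x] integrable_kernel_mult[OF assms(2), of x]
  by (simp add: integral_operator_def right_diff_distrib mult.left_commute[of _ c])

lemma T_cmult: "T (\<lambda>x. c * f x) x = c * T f x"
  by (simp add: integral_operator_def mult.left_commute[of _ c])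

lemma norm_integral_kernel_le:
  assumes f: "f \<in> L2 M" and D: "\<And>y. y \<in> space M \<Longrightarrow> cmod (D y) \<le> e" and "e \<ge> 0"
    and Dm: "D \<in> borel_measurable M"
  shows "cmod (\<integral>y. D y * f y \<partial>M) \<le> e * (\<integral>y. cmod (f y) \<partial>M)"
proof -
  have ei: "integrable M (\<lambda>y. e * cmod (f y))" using integrable_of_L2[OF f] by simp
  have le: "cmod (D y * f y) \<le> e * cmod (f y)" if "y \<in> space M" for y
    using D[OF that] by (simp add: norm_mult mult_right_mono)
  have int: "integrable M (\<lambda>y. D y * f y)"
  proof (rule Bochner_Integration.integrable_bound[OF ei])
    show "AE y in M. norm (D y * f y) \<le> norm (e * cmod (f y))"
      using le by (intro AE_I2) (simp add: order_trans[OF _ abs_ge_self])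
    show "(\<lambda>y. D y * f y) \<in> borel_measurable M"
      using Dm L2D(1)[OF f] by (intro borel_measurable_times)
  qed
  have "cmod (\<integral>y. D y * f y \<partial>M) \<le> (\<integral>y. cmod (D y * f y) \<partial>M)" by (rule integral_norm_bound)
  also have "\<dots> \<le> (\<integral>y. e * cmod (f y) \<partial>M)" by (rule integral_mono[OF integrable_norm[OF int] ei le])
  finally show ?thesis by simp
qed

lemma norm_T_le: "f \<in> L2 M \<Longrightarrow> cmod (T f x) \<le> K * (\<integral>y. cmod (f y) \<partial>M)"
  unfolding integral_operator_def
  by (rule norm_integral_kernel_le) (auto intro: kernel_bound K_nonneg section_measurable)

lemma T_in_L2:
  assumes f: "f \<in> L2 M"
  shows "T f \<in> L2 M"
proof (rule L2_of_bounded)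
  note [measurable] = kernel_measurable L2D(1)[OF f]
  have "T f \<in> borel_measurable M"
    unfolding integral_operator_def by measurable
  then show "integrable M (T f)"
    using norm_T_le[OF f] by (intro integrable_const_bound[where B = "K * (\<integral>y. cmod (f y) \<partial>M)"]) auto
qed (rule norm_T_le[OF f])

lemma T_hermitian:
  assumes f: "f \<in> L2 M" and g: "g \<in> L2 M"
  shows "L2_inner M (T g) f = cnj (L2_inner M (T f) g)"
proof -
  interpret P: pair_sigma_finite M M ..
  note [measurable] = kernel_measurable L2D(1)[OF f] L2D(1)[OF g]
  have int: "integrable (M \<Otimes>\<^sub>M M) (\<lambda>(x, y). C x y * f y * cnj (g x))"
  proof (rule P.Fubini_integrable)
    show "(\<lambda>(x, y). C x y * f y * cnj (g x)) \<in> borel_measurable (M \<Otimes>\<^sub>M M)" by measurable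
    have i: "integrable M (\<lambda>y. C x y * f y * cnj (g x))" for x
      using integrable_kernel_mult[OF f, of x] by simp
    then show "AE x in M. integrable M (\<lambda>y. case (x, y) of (x, y) \<Rightarrow> C x y * f y * cnj (g x))"
      by simp
    have "integrable M (\<lambda>x. \<integral>y. cmod (C x y * f y * cnj (g x)) \<partial>M)"
    proof (rule Bochner_Integration.integrable_bound)
      show "integrable M (\<lambda>x. K * (\<integral>y. cmod (f y) \<partial>M) * cmod (g x))"
        using integrable_of_L2[OF g] by simp
      show "(\<lambda>x. \<integral>y. cmod (C x y * f y * cnj (g x)) \<partial>M) \<in> borel_measurable M" by measurable
      have "(\<integral>y. cmod (C x y * f y * cnj (g x)) \<partial>M) \<le> K * (\<integral>y. cmod (f y) \<partial>M) * cmod (g x)" for x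
      proof -
        have "(\<integral>y. cmod (C x y * f y * cnj (g x)) \<partial>M) \<le> (\<integral>y. K * cmod (f y) * cmod (g x) \<partial>M)"
        proof (rule integral_mono[OF integrable_norm[OF i]])
          show "integrable M (\<lambda>y. K * cmod (f y) * cmod (g x))"
            using integrable_of_L2[OF f] by simp
          show "cmod (C x y * f y * cnj (g x)) \<le> K * cmod (f y) * cmod (g x)" for y
            by (auto simp: norm_mult intro!: mult_right_mono kernel_bound)
        qed
        then show ?thesis by simp
      qed
      then show "AE x in M. norm (\<integral>y. cmod (C x y * f y * cnj (g x)) \<partial>M) \<le>
          norm (K * (\<integral>y. cmod (f y) \<partial>M) * cmod (g x))"
        by (intro AE_I2) (simp add: order_trans[OF _ abs_ge_self])
    qed
    then show "integrable M (\<lambda>x. \<integral>y. norm (case (x, y) of (x, y) \<Rightarrow> C x y * f y * cnj (g x)) \<partial>M)"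
      by simp
  qed
  have "L2_inner M (T f) g = (\<integral>x. \<integral>y. C x y * f y * cnj (g x) \<partial>M \<partial>M)"
    by (simp add: L2_inner_def integral_operator_def)
  also have "\<dots> = (\<integral>y. \<integral>x. C x y * f y * cnj (g x) \<partial>M \<partial>M)"
    by (rule P.Fubini_integral[symmetric]) (use int in simp)
  also have "\<dots> = (\<integral>y. cnj (T g y * cnj (f y)) \<partial>M)"
  proof (rule Bochner_Integration.integral_cong[OF refl])
    fix y
    have "(\<integral>x. C x y * f y * cnj (g x) \<partial>M) = (\<integral>x. cnj (C y x * g x) * f y \<partial>M)"
    proof (rule Bochner_Integration.integral_cong[OF refl])
      fix x
      show "C x y * f y * cnj (g x) = cnj (C y x * g x) * f y"
        using kernel_hermitian[of x y] by (simp add: mult_ac)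
    qed
    also have "\<dots> = cnj (T g y * cnj (f y))"
      by (simp add: integral_operator_def del: complex_cnj_mult) simp
    finally show "(\<integral>x. C x y * f y * cnj (g x) \<partial>M) = cnj (T g y * cnj (f y))" .
  qed
  also have "\<dots> = cnj (L2_inner M (T g) f)"
    unfolding L2_inner_def by (rule Bochner_Integration.integral_cnj)
  finally show ?thesis by simp
qed

lemma norm_L2_inner_T_le:
  assumes f: "f \<in> L2 M"
  shows "cmod (L2_inner M (T f) f) \<le> K * mass * L2_square M f"
proof -
  have "cnj (L2_inner M (T f) f) = (\<integral>y. cnj (T f y) * f y \<partial>M)"
    unfolding L2_inner_def by (subst Bochner_Integration.integral_cnj[symmetric]) (simp del: Bochner_Integration.integral_cnj)
  then have "cmod (L2_inner M (T f) f) = cmod (\<integral>y. cnj (T f y) * f y \<partial>M)"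
    by (metis complex_mod_cnj)
  also have "\<dots> \<le> (K * (\<integral>y. cmod (f y) \<partial>M)) * (\<integral>y. cmod (f y) \<partial>M)"
    using norm_T_le[OF f] K_nonneg L2D(1)[OF L2_cnj[OF T_in_L2[OF f]]]
    by (intro norm_integral_kernel_le[OF f]) auto
  also have "\<dots> = K * (\<integral>y. cmod (f y) \<partial>M)\<^sup>2" by (simp add: power2_eq_square)
  also have "\<dots> \<le> K * (mass * L2_square M f)"
    by (intro mult_left_mono integral_norm_le f K_nonneg)
  finally show ?thesis by (simp add: mult.assoc)
qed

text \<open>
  The form \<open>m <f, g> - <T f, g>\<close> is non-negative, so a vector at which it nearly vanishes is
  nearly in its kernel. With the residual \<open>r = m f - T f\<close>, the non-negativity at \<open>f - s r\<close> reads
  \<open>0 \<le> d - 2 s |r|\<^sup>2 + s\<^sup>2 (m |r|\<^sup>2 - <T r, r>)\<close>, where \<open>d\<close> is the value at \<open>f\<close>.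
\<close>

lemma residual_le:
  assumes m: "m > 0" and max: "\<And>g. g \<in> L2 M \<Longrightarrow> Re (L2_inner M (T g) g) \<le> m * L2_square M g"
    and f: "f \<in> L2 M"
  shows "L2_square M (\<lambda>x. complex_of_real m * f x - T f x) \<le>
    (m + K * mass) * (m * L2_square M f - Re (L2_inner M (T f) f))"
proof -
  define r where "r = (\<lambda>x. complex_of_real m * f x - T f x)"
  define c where "c = m + K * mass"
  define d where "d = m * L2_square M f - Re (L2_inner M (T f) f)"
  define N where "N = L2_square M r"
  have c: "c > 0" using m K_nonneg by (simp add: c_def add_pos_nonneg)
  have Tf: "T f \<in> L2 M" by (rule T_in_L2[OF f])
  have r: "r \<in> L2 M" unfolding r_def by (intro L2_diff L2_cmult f Tf)
  have Tr: "T r \<in> L2 M" by (rule T_in_L2[OF r])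
  \<comment> \<open>the minimiser of \<open>s\<^sup>2 c - 2 s\<close>, where \<open>c |r|\<^sup>2\<close> bounds the quadratic term\<close>
  define s where "s = 1 / c"
  define g where "g = (\<lambda>x. f x - complex_of_real s * r x)"
  have g: "g \<in> L2 M" unfolding g_def by (intro L2_diff L2_cmult f r)
  have Tg: "T g = (\<lambda>x. T f x - complex_of_real s * T r x)"
    unfolding g_def using T_diff[OF f r] by auto
  have Xg: "Re (L2_inner M (T g) g) = Re (L2_inner M (T f) f) - 2 * (s * Re (L2_inner M (T f) r)) + s\<^sup>2 * Re (L2_inner M (T r) r)"
    unfolding Tg unfolding g_def
    by (subst Re_L2_inner_expand[OF Tf Tr f r]) (simp add: T_hermitian[OF f r])
  have "L2_square M g = L2_square M f - 2 * (s * Re (L2_inner M f r)) + s\<^sup>2 * N"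
    using Re_L2_inner_expand[OF f r f r, of s] L2_inner_commute[of M r f]
    by (simp add: L2_inner_self g_def N_def)
  then have Fg: "m * L2_square M g = m * L2_square M f - 2 * (s * (m * Re (L2_inner M f r))) + m * (s\<^sup>2 * N)"
    by (simp only: right_diff_distrib distrib_left mult.left_commute[of m 2] mult.left_commute[of m s])
  have "L2_inner M r r = complex_of_real m * L2_inner M f r - L2_inner M (T f) r"
    using L2_inner_diff_left[OF L2_cmult[OF f] Tf r, of "complex_of_real m" 1]
    by (simp add: r_def L2_inner_def mult.assoc)
  then have "Re (L2_inner M r r) = m * Re (L2_inner M f r) - Re (L2_inner M (T f) r)" by simp
  then have "N = m * Re (L2_inner M f r) - Re (L2_inner M (T f) r)" by (simp add: L2_inner_self N_def)
  then have cross: "s * N = s * (m * Re (L2_inner M f r)) - s * Re (L2_inner M (T f) r)"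
    by (simp only: right_diff_distrib)
  have "- Re (L2_inner M (T r) r) \<le> K * mass * N"
    using norm_L2_inner_T_le[OF r] abs_Re_le_cmod[of "L2_inner M (T r) r"] unfolding N_def by linarith
  then have "s\<^sup>2 * (- Re (L2_inner M (T r) r)) \<le> s\<^sup>2 * (K * mass * N)"
    by (rule mult_left_mono) simp
  then have Xr: "- (s\<^sup>2 * Re (L2_inner M (T r) r)) \<le> s\<^sup>2 * (K * mass * N)" by simp
  have sN: "m * (s\<^sup>2 * N) + s\<^sup>2 * (K * mass * N) = s * N"
  proof -
    have "m * (s\<^sup>2 * N) + s\<^sup>2 * (K * mass * N) = s * (s * c) * N"
      by (simp add: c_def power2_eq_square algebra_simps)
    then show ?thesis using c by (simp add: s_def)
  qed
  have "s * N \<le> d"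
    using max[OF g] Xr unfolding Xg Fg d_def using cross sN by linarith
  then show ?thesis
    using c by (simp add: s_def N_def r_def c_def d_def field_simps)
qed

text \<open>
  Take \<open>m\<close> to be the supremum of the form over the unit sphere and \<open>f\<close> a maximising sequence.
\<close>

theorem approximate_eigenvectors:
  assumes h: "h \<in> L2 M" and large: "L2_square M h < Re (L2_inner M (T h) h)"
  obtains m f where "m > 1" "\<And>n::nat. f n \<in> L2 M" "\<And>n. L2_square M (f n) = 1"
    "(\<lambda>n. L2_square M (\<lambda>x. complex_of_real m * f n x - T (f n) x)) \<longlonglongrightarrow> 0"
proof -
  define A where "A = {Re (L2_inner M (T f) f) |f. f \<in> L2 M \<and> L2_square M f = 1}"
  have normalise: "Re (L2_inner M (T f) f) / L2_square M f \<in> A" if f: "f \<in> L2 M" and pos: "L2_square M f > 0" for f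
  proof -
    define c where "c = complex_of_real (1 / sqrt (L2_square M f))"
    have cc: "c * cnj c = complex_of_real (1 / L2_square M f)"
      using pos by (simp add: c_def flip: of_real_mult)
    have cf: "(\<lambda>x. c * f x) \<in> L2 M" by (rule L2_cmult[OF f])
    have "(cmod c)\<^sup>2 = 1 / L2_square M f"
      unfolding c_def norm_of_real using pos by (simp add: power_divide)
    then have "L2_square M (\<lambda>x. c * f x) = 1"
      using pos by (simp add: L2_square_cmult)
    moreover have "L2_inner M (T (\<lambda>x. c * f x)) (\<lambda>x. c * f x) = (c * cnj c) * L2_inner M (T f) f"
      by (simp add: L2_inner_def T_cmult mult_ac flip: integral_mult_right_zero)
    then have "Re (L2_inner M (T (\<lambda>x. c * f x)) (\<lambda>x. c * f x)) = Re (L2_inner M (T f) f) / L2_square M f"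
      unfolding cc by simp
    ultimately show ?thesis unfolding A_def using cf by force
  qed
  have bdd: "bdd_above A"
  proof (rule bdd_aboveI)
    fix a assume "a \<in> A"
    then show "a \<le> K * mass"
      using norm_L2_inner_T_le complex_Re_le_cmod order_trans unfolding A_def by fastforce
  qed
  define m where "m = Sup A"
  have zero: "Re (L2_inner M (T g) g) \<le> 0" if "g \<in> L2 M" "L2_square M g = 0" for g
    using norm_L2_inner_T_le[OF that(1)] that(2) complex_Re_le_cmod[of "L2_inner M (T g) g"] by simp
  have hpos: "L2_square M h > 0"
    using zero[OF h] large L2_square_nonneg[of M h] by linarith
  have "1 < Re (L2_inner M (T h) h) / L2_square M h" using large hpos by simp
  also have "\<dots> \<le> m" unfolding m_def by (rule cSup_upper[OF normalise[OF h hpos] bdd])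
  finally have m: "m > 1" .
  have max: "Re (L2_inner M (T g) g) \<le> m * L2_square M g" if g: "g \<in> L2 M" for g
  proof (cases "L2_square M g = 0")
    case True then show ?thesis using zero[OF g] by simp
  next
    case False
    then have pos: "L2_square M g > 0" using L2_square_nonneg[of M g] by simp
    then have "Re (L2_inner M (T g) g) / L2_square M g \<le> m"
      unfolding m_def by (intro cSup_upper[OF normalise[OF g] bdd])
    then show ?thesis using pos by (simp add: pos_divide_le_eq)
  qed
  have "\<exists>f. f \<in> L2 M \<and> L2_square M f = 1 \<and> m - 1 / real (Suc n) < Re (L2_inner M (T f) f)" for n
  proof -
    have "m - 1 / real (Suc n) < Sup A" by (simp add: m_def)
    then obtain a where "a \<in> A" "m - 1 / real (Suc n) < a"
      using less_cSup_iff[OF _ bdd] normalise[OF h hpos] by blast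
    then show ?thesis unfolding A_def by blast
  qed
  then obtain f where f: "\<And>n. f n \<in> L2 M" "\<And>n. L2_square M (f n) = 1"
    "\<And>n. m - 1 / real (Suc n) < Re (L2_inner M (T (f n)) (f n))" by metis
  have "(\<lambda>n. L2_square M (\<lambda>x. complex_of_real m * f n x - T (f n) x)) \<longlonglongrightarrow> 0"
  proof (rule tendsto_sandwich[where f = "\<lambda>_. 0"])
    show "\<forall>\<^sub>F n in sequentially. L2_square M (\<lambda>x. complex_of_real m * f n x - T (f n) x) \<le> (m + K * mass) * (1 / real (Suc n))"
    proof (intro always_eventually allI)
      fix n
      have "L2_square M (\<lambda>x. complex_of_real m * f n x - T (f n) x) \<le>
          (m + K * mass) * (m * L2_square M (f n) - Re (L2_inner M (T (f n)) (f n)))"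
        by (rule residual_le[OF _ max f(1)]) (use m in simp)
      also have "\<dots> \<le> (m + K * mass) * (1 / real (Suc n))"
        using f(2,3)[of n] m K_nonneg by (intro mult_left_mono) auto
      finally show "L2_square M (\<lambda>x. complex_of_real m * f n x - T (f n) x) \<le> (m + K * mass) * (1 / real (Suc n))" .
    qed
    show "(\<lambda>n. (m + K * mass) * (1 / real (Suc n))) \<longlonglongrightarrow> 0"
      using tendsto_mult_right_zero[OF LIMSEQ_inverse_real_of_nat[unfolded inverse_eq_divide]] .
  qed (simp_all add: L2_square_nonneg)
  from that[OF m f(1,2) this] show ?thesis .
qed

end

section \<open>Large quadratic forms give large eigenvalues\<close>

lemma hermitian_kernel_operator_compact:
  fixes C :: "'a::euclidean_space \<Rightarrow> 'a \<Rightarrow> complex"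
  assumes S: "compact S" and cont: "continuous_on UNIV (\<lambda>(x, y). C x y)"
    and bd: "\<And>x y. cmod (C x y) \<le> K" and herm: "\<And>x y. C x y = cnj (C y x)"
  shows "hermitian_kernel_operator (restrict_space lborel S) C K"
proof -
  let ?M = "restrict_space lborel S"
  have Sb: "S \<in> sets borel" using S by (rule borel_compact)
  have "(\<lambda>(x, y). C x y) \<in> borel_measurable borel"
    by (rule borel_measurable_continuous_onI[OF cont])
  then have C: "(\<lambda>(x, y). C x y) \<in> borel_measurable (borel \<Otimes>\<^sub>M borel)"
    by (simp add: borel_prod)
  have [measurable]: "(\<lambda>x. x) \<in> ?M \<rightarrow>\<^sub>M borel"
    by (rule measurable_restrict_space1) simp
  have fin: "finite_measure ?M"
    using emeasure_compact_finite[OF S] Sb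
    by (intro finite_measureI) (simp add: emeasure_restrict_space space_restrict_space less_top)
  have meas: "(\<lambda>(x, y). C x y) \<in> borel_measurable (?M \<Otimes>\<^sub>M ?M)"
  proof -
    have "(\<lambda>p. (fst p, snd p)) \<in> ?M \<Otimes>\<^sub>M ?M \<rightarrow>\<^sub>M borel \<Otimes>\<^sub>M borel"
      by (intro measurable_Pair measurable_compose[OF measurable_fst] measurable_compose[OF measurable_snd]) measurable
    from measurable_compose[OF this C] show ?thesis by (simp add: split_beta')
  qed
  have sec: "C x \<in> borel_measurable ?M" for x
  proof -
    have "continuous_on UNIV (C x)"
      using continuous_on_compose2[OF cont, of UNIV "\<lambda>y. (x, y)"] by (simp add: continuous_intros)
    then show ?thesis
      by (intro measurable_restrict_space1) (simp add: borel_measurable_continuous_onI)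
  qed
  show ?thesis
    by (rule hermitian_kernel_operator.intro[OF fin hermitian_kernel_operator_axioms.intro[OF meas sec bd herm]])
qed

text \<open>
  Approximate eigenvectors \<open>f\<^sub>n\<close> are bounded in \<open>L\<^sup>1\<close>, so uniform continuity of the kernel on
  \<open>S \<times> S\<close> makes the functions \<open>T f\<^sub>n\<close> equicontinuous. If a subsequence of them converges uniformly
  to \<open>g\<close>, then \<open>T (T f\<^sub>n) = m T f\<^sub>n - T (m f\<^sub>n - T f\<^sub>n)\<close> converges to both \<open>T g\<close> and \<open>m g\<close>.
\<close>

theorem exists_eigenvalue_gt_1:
  fixes C :: "'a::euclidean_space \<Rightarrow> 'a \<Rightarrow> complex"
  assumes S: "compact S" and cont: "continuous_on UNIV (\<lambda>(x, y). C x y)"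
    and bd: "\<And>x y. cmod (C x y) \<le> K" and herm: "\<And>x y. C x y = cnj (C y x)"
    and h: "h \<in> L2 (restrict_space lborel S)"
    and large: "L2_square (restrict_space lborel S) h <
      Re (L2_inner (restrict_space lborel S) (integral_operator (restrict_space lborel S) C h) h)"
  shows "\<exists>m>1. complex_of_real m \<in> kernel_eigenvalues C S"
proof -
  let ?M = "restrict_space lborel S"
  interpret hermitian_kernel_operator ?M C K
    by (rule hermitian_kernel_operator_compact[OF S cont bd herm])
  have spM: "space ?M = S" by (simp add: space_restrict_space)
  obtain m f where m: "m > 1" and f: "\<And>n::nat. f n \<in> L2 ?M" "\<And>n. L2_square ?M (f n) = 1"
    and res: "(\<lambda>n. L2_square ?M (\<lambda>x. complex_of_real m * f n x - T (f n) x)) \<longlonglongrightarrow> 0"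
    using approximate_eigenvectors[OF h large] by blast
  define W where "W = sqrt mass"
  have W0: "W \<ge> 0" by (simp add: W_def)
  have fW: "(\<integral>x. cmod (f n x) \<partial>?M) \<le> W" for n
    unfolding W_def using integral_norm_le[OF f(1)[of n]] f(2)[of n] by (intro real_le_rsqrt) simp
  have fpos: "0 \<le> (\<integral>x. cmod (f n x) \<partial>?M)" for n by simp
  have equicont: "\<exists>d>0. \<forall>n y. y \<in> S \<and> norm (x - y) < d \<longrightarrow> norm (T (f n) x - T (f n) y) < e"
    if x: "x \<in> S" and e: "e > 0" for x e
  proof -
    have "uniformly_continuous_on (S \<times> S) (\<lambda>(x, y). C x y)"
      by (rule compact_uniformly_continuous[OF continuous_on_subset[OF cont] compact_Times[OF S S]]) simp
    moreover have "e / (W + 1) > 0" using e W0 by simp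
    ultimately obtain d where d: "d > 0"
      "\<And>p q. p \<in> S \<times> S \<Longrightarrow> q \<in> S \<times> S \<Longrightarrow> dist q p < d \<Longrightarrow>
        dist ((\<lambda>(x, y). C x y) q) ((\<lambda>(x, y). C x y) p) < e / (W + 1)"
      unfolding uniformly_continuous_on_def by metis
    have "norm (T (f n) x - T (f n) y) < e" if y: "y \<in> S" "norm (x - y) < d" for n y
    proof -
      have close: "cmod (C x z - C y z) \<le> e / (W + 1)" if "z \<in> space ?M" for z
        using d(2)[of "(y, z)" "(x, z)"] x y that by (simp add: spM dist_Pair_Pair dist_norm)
      have "T (f n) x - T (f n) y = (\<integral>z. (C x z - C y z) * f n z \<partial>?M)"
        using integrable_kernel_mult[OF f(1)[of n]] by (simp add: integral_operator_def left_diff_distrib)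
      also have "cmod \<dots> \<le> e / (W + 1) * (\<integral>z. cmod (f n z) \<partial>?M)"
        using e W0 section_measurable by (intro norm_integral_kernel_le[OF f(1)] close) auto
      also have "\<dots> \<le> e / (W + 1) * W"
        using e W0 by (intro mult_left_mono fW) simp
      also have "\<dots> < e" using e W0 by (simp add: field_simps)
      finally show ?thesis .
    qed
    then show ?thesis using d(1) by blast
  qed
  have TfK: "norm (T (f n) x) \<le> K * W" for n x
    using norm_T_le[OF f(1)[of n], of x] mult_left_mono[OF fW[of n] K_nonneg] by linarith
  obtain g k where g: "continuous_on S g" and k: "strict_mono (k :: nat \<Rightarrow> nat)"
    and lim: "\<And>e. 0 < e \<Longrightarrow> \<exists>N. \<forall>n x. n \<ge> N \<and> x \<in> S \<longrightarrow> norm (T (f (k n)) x - g x) < e"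
    using Arzela_Ascoli[OF S, of "\<lambda>n. T (f n)" "K * W", OF TfK equicont] by blast
  have gm[measurable]: "g \<in> borel_measurable ?M"
    using borel_measurable_continuous_on_restrict[OF g]
    by (simp add: measurable_def space_restrict_space sets_restrict_space)
  have gb: "cmod (g x) \<le> K * W + 1" if x: "x \<in> S" for x
  proof -
    obtain N where "norm (T (f (k N)) x - g x) < 1" using lim[of 1] x by (metis order_refl zero_less_one)
    then show ?thesis
      using TfK[of "k N" x] norm_triangle_ineq3[of "T (f (k N)) x" "g x"] by linarith
  qed
  have g2: "g \<in> L2 ?M"
  proof -
    have "integrable ?M (\<lambda>x. (cmod (g x))\<^sup>2)"
    proof (rule integrable_const_bound[where B = "(K * W + 1)\<^sup>2"])
      show "AE x in ?M. norm ((cmod (g x))\<^sup>2) \<le> (K * W + 1)\<^sup>2"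
        using gb by (intro AE_I2) (simp add: spM power_mono)
    qed measurable
    then show ?thesis by (simp add: L2_def)
  qed
  have eig: "T g x = complex_of_real m * g x" if x: "x \<in> S" for x
  proof (rule LIMSEQ_unique)
    let ?r = "\<lambda>n y. complex_of_real m * f (k n) y - T (f (k n)) y"
    have Tf: "T (f n) \<in> L2 ?M" for n by (rule T_in_L2[OF f(1)])
    have r: "?r n \<in> L2 ?M" for n by (intro L2_diff L2_cmult f Tf)
    show "(\<lambda>n. T (T (f (k n))) x) \<longlonglongrightarrow> T g x"
    proof (rule LIMSEQ_I)
      fix e :: real assume e: "e > 0"
      have e': "e / (K * mass + 1) > 0" using e K_nonneg by (simp add: add_nonneg_pos)
      obtain N where N: "\<And>n y. n \<ge> N \<Longrightarrow> y \<in> S \<Longrightarrow> norm (T (f (k n)) y - g y) < e / (K * mass + 1)"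
        using lim[OF e'] by blast
      have "norm (T (T (f (k n))) x - T g x) < e" if n: "n \<ge> N" for n
      proof -
        have d2: "(\<lambda>y. T (f (k n)) y - 1 * g y) \<in> L2 ?M" by (intro L2_diff L2_cmult Tf g2)
        have "T (T (f (k n))) x - T g x = T (\<lambda>y. T (f (k n)) y - 1 * g y) x"
          using T_diff[OF Tf[of "k n"] g2, of 1 x] by simp
        also have "cmod \<dots> \<le> K * (\<integral>y. cmod (T (f (k n)) y - 1 * g y) \<partial>?M)"
          by (rule norm_T_le[OF d2])
        also have "\<dots> \<le> K * (\<integral>y. e / (K * mass + 1) \<partial>?M)"
        proof (intro mult_left_mono K_nonneg integral_mono)
          show "integrable ?M (\<lambda>y. cmod (T (f (k n)) y - 1 * g y))"
            by (rule integrable_norm[OF integrable_of_L2[OF d2]])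
          show "cmod (T (f (k n)) y - 1 * g y) \<le> e / (K * mass + 1)" if "y \<in> space ?M" for y
            using N[OF n, of y] that by (simp add: spM)
        qed simp
        also have "\<dots> = e * (K * mass / (K * mass + 1))" by simp
        also have "\<dots> < e * 1"
          using e K_nonneg by (intro mult_strict_left_mono) (simp_all add: add_nonneg_pos)
        finally show ?thesis by simp
      qed
      then show "\<exists>N. \<forall>n\<ge>N. norm (T (T (f (k n))) x - T g x) < e" by blast
    qed
    have "(\<lambda>n. T (f (k n)) x) \<longlonglongrightarrow> g x"
    proof (rule LIMSEQ_I)
      fix e :: real assume "e > 0"
      then show "\<exists>N. \<forall>n\<ge>N. norm (T (f (k n)) x - g x) < e" using lim[of e] x by blast
    qed
    moreover have "(\<lambda>n. T (?r n) x) \<longlonglongrightarrow> 0"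
    proof (rule Lim_null_comparison)
      show "\<forall>\<^sub>F n in sequentially. norm (T (?r n) x) \<le> K * sqrt (mass * L2_square ?M (?r n))"
      proof (intro always_eventually allI)
        fix n
        have "norm (T (?r n) x) \<le> K * (\<integral>y. cmod (?r n y) \<partial>?M)" by (rule norm_T_le[OF r])
        also have "\<dots> \<le> K * sqrt (mass * L2_square ?M (?r n))"
          by (intro mult_left_mono K_nonneg real_le_rsqrt integral_norm_le r)
        finally show "norm (T (?r n) x) \<le> K * sqrt (mass * L2_square ?M (?r n))" .
      qed
      have "(\<lambda>n. L2_square ?M (?r n)) \<longlonglongrightarrow> 0"
        using LIMSEQ_subseq_LIMSEQ[OF res k] by (simp add: comp_def)
      then have "(\<lambda>n. K * sqrt (mass * L2_square ?M (?r n))) \<longlonglongrightarrow> K * sqrt (mass * 0)"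
        by (intro tendsto_intros)
      then show "(\<lambda>n. K * sqrt (mass * L2_square ?M (?r n))) \<longlonglongrightarrow> 0" by simp
    qed
    ultimately have "(\<lambda>n. complex_of_real m * T (f (k n)) x - T (?r n) x) \<longlonglongrightarrow> complex_of_real m * g x - 0"
      by (intro tendsto_intros)
    moreover have "T (?r n) x = complex_of_real m * T (f (k n)) x - T (T (f (k n))) x" for n
      using T_diff[OF L2_cmult[OF f(1)[of "k n"]] Tf, of "complex_of_real m" 1 "k n" x] by (simp add: T_cmult)
    ultimately show "(\<lambda>n. T (T (f (k n))) x) \<longlonglongrightarrow> complex_of_real m * g x" by simp
  qed
  \<comment> \<open>otherwise \<open>T f\<^sub>n\<close> and the residuals are small, hence so is \<open>m f\<^sub>n\<close>, although \<open>f\<^sub>n\<close> has norm 1\<close>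
  have nz: "\<not> (AE x in ?M. g x = 0)"
  proof
    assume g0: "AE x in ?M. g x = 0"
    define e where "e = 1 / (4 * (W + 1))"
    have e: "e > 0" using W0 by (simp add: e_def)
    obtain N1 where N1: "\<And>n y. n \<ge> N1 \<Longrightarrow> y \<in> S \<Longrightarrow> norm (T (f (k n)) y - g y) < e"
      using lim[OF e] by blast
    have "(\<lambda>n. L2_square ?M (\<lambda>y. complex_of_real m * f (k n) y - T (f (k n)) y)) \<longlonglongrightarrow> 0"
      using LIMSEQ_subseq_LIMSEQ[OF res k] by (simp add: comp_def)
    from order_tendstoD(2)[OF this, of "1/8"] obtain N2 where
      N2: "\<And>n. n \<ge> N2 \<Longrightarrow> L2_square ?M (\<lambda>y. complex_of_real m * f (k n) y - T (f (k n)) y) < 1/8"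
      by (auto simp: eventually_sequentially)
    define n where "n = max N1 N2"
    define r where "r = (\<lambda>y. complex_of_real m * f (k n) y - T (f (k n)) y)"
    have Tf: "T (f (k n)) \<in> L2 ?M" by (rule T_in_L2[OF f(1)])
    have r: "r \<in> L2 ?M" unfolding r_def by (intro L2_diff L2_cmult f Tf)
    have "L2_square ?M (T (f (k n))) \<le> (\<integral>y. e\<^sup>2 \<partial>?M)"
      unfolding L2_square_def
    proof (rule integral_mono_AE)
      show "AE y in ?M. (cmod (T (f (k n)) y))\<^sup>2 \<le> e\<^sup>2"
        using g0 AE_space
      proof eventually_elim
        fix y assume "g y = 0" "y \<in> space ?M"
        then show "(cmod (T (f (k n)) y))\<^sup>2 \<le> e\<^sup>2"
          using N1[of n y] by (intro power_mono) (simp_all add: spM n_def)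
      qed
    qed (simp_all add: L2D[OF Tf])
    also have "\<dots> = (e * W)\<^sup>2" by (simp add: W_def power_mult_distrib)
    also have "\<dots> \<le> (1/4)\<^sup>2"
      using W0 by (intro power_mono) (simp_all add: e_def field_simps)
    finally have small: "L2_square ?M (T (f (k n))) \<le> 1/16" by (simp add: power2_eq_square)
    have "m\<^sup>2 = L2_square ?M (\<lambda>y. complex_of_real m * f (k n) y)"
      by (simp add: L2_square_cmult f(2))
    also have "\<dots> \<le> (\<integral>y. 2 * (cmod (r y))\<^sup>2 + 2 * (cmod (T (f (k n)) y))\<^sup>2 \<partial>?M)"
      unfolding L2_square_def
    proof (rule integral_mono)
      show "integrable ?M (\<lambda>y. (cmod (complex_of_real m * f (k n) y))\<^sup>2)"
        by (rule L2D(2)[OF L2_cmult[OF f(1)]])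
      show "integrable ?M (\<lambda>y. 2 * (cmod (r y))\<^sup>2 + 2 * (cmod (T (f (k n)) y))\<^sup>2)"
        using L2D(2)[OF r] L2D(2)[OF Tf] by simp
      show "(cmod (complex_of_real m * f (k n) y))\<^sup>2 \<le> 2 * (cmod (r y))\<^sup>2 + 2 * (cmod (T (f (k n)) y))\<^sup>2" for y
        using norm_add_square_le[of "r y" "T (f (k n)) y"] by (simp add: r_def)
    qed
    also have "\<dots> = 2 * L2_square ?M r + 2 * L2_square ?M (T (f (k n)))"
      using L2D(2)[OF r] L2D(2)[OF Tf] by (simp add: L2_square_def)
    also have "\<dots> < 1" using small N2[of n] by (simp add: n_def r_def)
    finally show False using m by (simp add: power2_less_1_iff)
  qed
  have "complex_of_real m \<in> kernel_eigenvalues C S"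
    unfolding kernel_eigenvalues_def Let_def
  proof (intro CollectI bexI[OF _ g2] conjI nz)
    show "AE x in ?M. T g x = complex_of_real m * g x"
      using eig by (intro AE_I2) (simp add: spM)
  qed
  with m show ?thesis by blast
qed

section \<open>Eigenvalues on compact sets and the quadratic form\<close>

lemma
  fixes f h :: "'a::euclidean_space \<Rightarrow> complex"
  assumes S: "S \<in> sets borel"
  shows quadratic_form_restrict: "quadratic_form f (\<lambda>x. indicator S x *\<^sub>R h x) =
      L2_inner (restrict_space lborel S) (integral_operator (restrict_space lborel S) (\<lambda>x y. f (x - y)) h) h"
    and L2_square_restrict: "(\<integral>x. (cmod (indicator S x *\<^sub>R h x))\<^sup>2 \<partial>lborel) = L2_square (restrict_space lborel S) h"
proof -
  have "(\<integral>y. f (x - y) * (indicator S y *\<^sub>R h y) \<partial>lborel) * cnj (indicator S x *\<^sub>R h x) =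
      indicator S x *\<^sub>R ((\<integral>y. indicator S y *\<^sub>R (f (x - y) * h y) \<partial>lborel) * cnj (h x))" for x
    by (simp add: indicator_def)
  then show "quadratic_form f (\<lambda>x. indicator S x *\<^sub>R h x) =
      L2_inner (restrict_space lborel S) (integral_operator (restrict_space lborel S) (\<lambda>x y. f (x - y)) h) h"
    using S by (simp add: quadratic_form_def L2_inner_def integral_operator_def integral_restrict_space)
  have "(cmod (indicator S x *\<^sub>R h x))\<^sup>2 = indicator S x *\<^sub>R (cmod (h x))\<^sup>2" for x
    by (simp add: indicator_def)
  then show "(\<integral>x. (cmod (indicator S x *\<^sub>R h x))\<^sup>2 \<partial>lborel) = L2_square (restrict_space lborel S) h"
    using S by (simp add: L2_square_def integral_restrict_space)
qed

lemma quadratic_form_le_limit: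
  fixes f :: "'a::euclidean_space \<Rightarrow> complex"
  assumes "f \<in> borel_measurable borel" "\<And>x. cmod (f x) \<le> K"
    and "\<And>n. h n \<in> borel_measurable borel" "h' \<in> borel_measurable borel"
    and "\<And>x. (\<lambda>n. h n x) \<longlonglongrightarrow> h' x" "\<And>n x. cmod (h n x) \<le> w x" "integrable lborel w" "\<And>x. w x \<le> L"
    and le: "\<And>n. quadratic_form f (h n) \<le> complex_of_real (\<integral>x. (cmod (h n x))\<^sup>2 \<partial>lborel)"
  shows "quadratic_form f h' \<le> complex_of_real (\<integral>x. (cmod (h' x))\<^sup>2 \<partial>lborel)"
proof -
  note lim = quadratic_form_dominated_convergence[OF assms(1-8)]
  have "Re (quadratic_form f h') \<le> (\<integral>x. (cmod (h' x))\<^sup>2 \<partial>lborel)"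
    using le by (intro LIMSEQ_le[OF tendsto_Re[OF lim(1)] lim(2)]) (simp add: less_eq_complex_def)
  moreover have "Im (quadratic_form f h') = 0"
    using LIMSEQ_unique[OF tendsto_Im[OF lim(1)], of 0] le by (simp add: less_eq_complex_def)
  ultimately show ?thesis by (simp add: less_eq_complex_def)
qed

locale stationary_kernel =
  fixes f :: "'a::euclidean_space \<Rightarrow> complex" and K :: real
  assumes continuous: "continuous_on UNIV f"
    and bounded: "\<And>x. cmod (f x) \<le> K"
    and hermitian: "\<And>x. f (- x) = cnj (f x)"
begin

abbreviation kernel where "kernel \<equiv> (\<lambda>x y. f (x - y))"

lemma f_measurable [measurable]: "f \<in> borel_measurable borel"
  by (rule borel_measurable_continuous_onI[OF continuous])

lemma kernel_continuous: "continuous_on UNIV (\<lambda>(x, y). kernel x y)"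
  unfolding split_beta' by (intro continuous_on_compose2[OF continuous] continuous_intros) auto

lemma kernel_cnj: "kernel x y = cnj (kernel y x)"
  using hermitian[of "y - x"] by simp

lemma operator_on_compact: "compact S \<Longrightarrow> hermitian_kernel_operator (restrict_space lborel S) kernel K"
  by (rule hermitian_kernel_operator_compact[OF _ kernel_continuous bounded kernel_cnj])

text \<open>
  On every ball, the truncated function satisfies the bound, since otherwise there would be an
  eigenvalue above 1. The truncations converge to \<open>h\<close>.
\<close>

lemma quadratic_form_le_of_eigenvalues:
  assumes ev: "\<And>S l. compact S \<Longrightarrow> l \<in> kernel_eigenvalues kernel S \<Longrightarrow> l \<le> 1"
    and h: "test_function h"
  shows "quadratic_form f h \<le> complex_of_real (\<integral>x. (cmod (h x))\<^sup>2 \<partial>lborel)"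
proof -
  obtain L where h1: "integrable lborel h" and hc: "continuous_on UNIV h" and hb: "\<And>x. cmod (h x) \<le> L"
    using h by (auto simp: test_function_def)
  have [measurable]: "h \<in> borel_measurable borel" by (rule borel_measurable_continuous_onI[OF hc])
  define S where "S n = cball (0::'a) (real n)" for n
  have S: "compact (S n)" "S n \<in> sets borel" for n by (simp_all add: S_def)
  show ?thesis
  proof (rule quadratic_form_le_limit[where h = "\<lambda>n x. indicator (S n) x *\<^sub>R h x" and w = "\<lambda>x. cmod (h x)"])
    show "(\<lambda>x. indicator (S n) x *\<^sub>R h x) \<in> borel_measurable borel" for n
      using S(2)[of n] by measurable
    show "(\<lambda>n. indicator (S n) x *\<^sub>R h x) \<longlonglongrightarrow> h x" for x
    proof (rule tendsto_eventually)
      obtain N where "norm x \<le> real N" using real_arch_simple by blast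
      then have "indicator (S n) x *\<^sub>R h x = h x" if "n \<ge> N" for n
        using that by (simp add: S_def)
      then show "\<forall>\<^sub>F n in sequentially. indicator (S n) x *\<^sub>R h x = h x"
        by (auto simp: eventually_sequentially)
    qed
    show "cmod (indicator (S n) x *\<^sub>R h x) \<le> cmod (h x)" for n x
      by (simp add: indicator_def)
    show "quadratic_form f (\<lambda>x. indicator (S n) x *\<^sub>R h x) \<le>
        complex_of_real (\<integral>x. (cmod (indicator (S n) x *\<^sub>R h x))\<^sup>2 \<partial>lborel)" for n
    proof -
      let ?M = "restrict_space lborel (S n)"
      interpret hermitian_kernel_operator ?M kernel K by (rule operator_on_compact[OF S(1)])
      have hm: "h \<in> borel_measurable ?M" by (intro measurable_restrict_space1) simp
      have h2: "h \<in> L2 ?M"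
        by (rule L2_of_bounded[OF integrable_const_bound[where B=L]]) (use hb hm in auto)
      have "Im (L2_inner ?M (T h) h) = 0"
        using arg_cong[OF T_hermitian[OF h2 h2], of Im] by simp
      moreover have "Re (L2_inner ?M (T h) h) \<le> L2_square ?M h"
      proof (rule ccontr)
        assume "\<not> ?thesis"
        then obtain m where "m > 1" "complex_of_real m \<in> kernel_eigenvalues kernel (S n)"
          using exists_eigenvalue_gt_1[OF S(1) kernel_continuous bounded kernel_cnj h2] by auto
        with ev[OF S(1)] show False by (fastforce simp: less_eq_complex_def)
      qed
      ultimately show ?thesis
        unfolding quadratic_form_restrict[OF S(2)] L2_square_restrict[OF S(2)]
        by (simp add: less_eq_complex_def)
    qed
  qed (use h1 hb bounded in auto)
qed

text \<open>
  The eigenfunction is replaced by its continuous version, which the cutoffs turn into test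
  functions. A sharp truncation to \<open>S\<close> is obtained only in the limit, because the boundary of
  \<open>S\<close> may have positive measure.
\<close>

lemma eigenvalue_le_1_of_quadratic_form:
  assumes quad: "\<And>h. test_function h \<Longrightarrow> quadratic_form f h \<le> complex_of_real (\<integral>x. (cmod (h x))\<^sup>2 \<partial>lborel)"
    and S: "compact S" and l: "l \<in> kernel_eigenvalues kernel S"
  shows "l \<le> 1"
proof (cases "l = 0")
  case True then show ?thesis by (simp add: less_eq_complex_def)
next
  case l0: False
  let ?M = "restrict_space lborel S"
  interpret hermitian_kernel_operator ?M kernel K by (rule operator_on_compact[OF S])
  have Sb[measurable]: "S \<in> sets borel" using S by (rule borel_compact)
  obtain h where h: "h \<in> L2 ?M" and nz: "\<not> (AE x in ?M. h x = 0)"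
    and eig: "AE x in ?M. T h x = l * h x"
    using l by (auto simp: kernel_eigenvalues_def Let_def)
  have h1: "integrable ?M h" by (rule integrable_of_L2[OF h])
  \<comment> \<open>defined and continuous on the whole space, although \<open>h\<close> is only relevant on \<open>S\<close>\<close>
  define k where "k x = (1 / l) * T h x" for x
  have kh: "AE x in ?M. k x = h x"
    using eig by eventually_elim (simp add: k_def l0)
  have k2: "k \<in> L2 ?M" unfolding k_def by (rule L2_cmult[OF T_in_L2[OF h]])
  have Tk: "T k x = l * k x" for x
  proof -
    have "T k x = T h x"
      unfolding integral_operator_def
    proof (rule integral_cong_AE)
      show "AE y in ?M. kernel x y * k y = kernel x y * h y"
        using kh by eventually_elim simp
    qed (use L2D(1)[OF k2] L2D(1)[OF h] section_measurable in auto)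
    then show ?thesis by (simp add: k_def l0)
  qed
  have inner: "L2_inner ?M (T k) k = l * complex_of_real (L2_square ?M k)"
    unfolding L2_inner_self[symmetric] by (simp add: L2_inner_def Tk mult.assoc)
  have pos: "L2_square ?M k > 0"
  proof (rule ccontr)
    assume "\<not> ?thesis"
    then have "L2_square ?M k = 0" using L2_square_nonneg[of ?M k] by simp
    then have "AE x in ?M. (cmod (k x))\<^sup>2 = 0"
      unfolding L2_square_def using L2D(2)[OF k2] by (subst (asm) integral_nonneg_eq_0_iff_AE) auto
    then have "AE x in ?M. h x = 0"
      using kh by eventually_elim simp
    with nz show False by simp
  qed
  define L where "L = cmod (1 / l) * (K * (\<integral>y. cmod (h y) \<partial>?M))"
  have L: "cmod (k x) \<le> L" for x
    unfolding k_def norm_mult L_def by (intro mult_left_mono norm_T_le[OF h]) simp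
  have L0: "L \<ge> 0" using L[of 0] norm_ge_zero[of "k 0"] by linarith
  have kc: "continuous_on UNIV k"
    unfolding continuous_on_sequentially comp_def k_def integral_operator_def
  proof safe
    fix x and a :: 'a assume x: "(x :: nat \<Rightarrow> 'a) \<longlonglongrightarrow> a"
    show "(\<lambda>n. 1 / l * (\<integral>y. kernel (x n) y * h y \<partial>?M)) \<longlonglongrightarrow> 1 / l * (\<integral>y. kernel a y * h y \<partial>?M)"
    proof (intro tendsto_mult tendsto_const integral_dominated_convergence[where w = "\<lambda>y. K * cmod (h y)"])
      show "AE y in ?M. (\<lambda>n. kernel (x n) y * h y) \<longlonglongrightarrow> kernel a y * h y"
      proof (intro AE_I2 tendsto_mult tendsto_const)
        fix y
        show "(\<lambda>n. kernel (x n) y) \<longlonglongrightarrow> kernel a y"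
          by (rule continuous_on_tendsto_compose[OF continuous]) (use x in \<open>auto intro: tendsto_intros\<close>)
      qed
      show "AE y in ?M. norm (kernel (x n) y * h y) \<le> K * cmod (h y)" for n
        by (intro AE_I2) (auto simp: norm_mult intro!: mult_right_mono bounded)
    qed (use h1 L2D(1)[OF h] section_measurable in auto)
  qed
  obtain u :: "nat \<Rightarrow> 'a \<Rightarrow> real" and R where u: "\<And>n. continuous_on UNIV (u n)" "\<And>n x. 0 \<le> u n x"
    "\<And>n x. u n x \<le> indicator (cball 0 R) x" "\<And>x. (\<lambda>n. u n x) \<longlonglongrightarrow> indicator S x"
    using cutoff_functions[OF S] by blast
  have [measurable]: "k \<in> borel_measurable borel" by (rule borel_measurable_continuous_onI[OF kc])
  have [measurable]: "u n \<in> borel_measurable borel" for n by (rule borel_measurable_continuous_onI[OF u(1)])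
  let ?w = "\<lambda>x::'a. indicator (cball 0 R) x * L"
  have w: "integrable lborel ?w" using integrable_indicator_cball[of R, where 'a='a] by simp
  have wL: "?w x \<le> L" for x using L0 by (simp add: indicator_def)
  have uk: "cmod (u n x *\<^sub>R k x) \<le> ?w x" for n x
    using mult_mono[OF u(3)[of n x] L[of x]] u(2)[of n x] by simp
  have test: "test_function (\<lambda>x. u n x *\<^sub>R k x)" for n
    unfolding test_function_def
  proof (intro conjI exI allI)
    show "integrable lborel (\<lambda>x. u n x *\<^sub>R k x)"
    proof (rule Bochner_Integration.integrable_bound[OF w])
      show "AE x in lborel. norm (u n x *\<^sub>R k x) \<le> norm (?w x)"
        by (intro AE_I2) (simp only: real_norm_def order_trans[OF uk abs_ge_self])
    qed measurable
    show "continuous_on UNIV (\<lambda>x. u n x *\<^sub>R k x)" by (intro continuous_intros u kc)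
    show "cmod (u n x *\<^sub>R k x) \<le> L" for x by (rule order_trans[OF uk wL])
  qed
  have "quadratic_form f (\<lambda>x. indicator S x *\<^sub>R k x) \<le>
      complex_of_real (\<integral>x. (cmod (indicator S x *\<^sub>R k x))\<^sup>2 \<partial>lborel)"
    by (rule quadratic_form_le_limit[where h = "\<lambda>n x. u n x *\<^sub>R k x", OF _ bounded _ _ _ uk w wL quad[OF test]])
       (auto intro!: tendsto_intros u)
  then have "l * complex_of_real (L2_square ?M k) \<le> complex_of_real (L2_square ?M k)"
    unfolding quadratic_form_restrict[OF Sb] L2_square_restrict[OF Sb] inner .
  then show ?thesis using pos by (simp add: less_eq_complex_def)
qed

end

section \<open>Stationary covariance functions\<close>

lemma stationary_covariance_hermitian:
  fixes C0 :: "'a::ab_group_add \<Rightarrow> complex"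
  assumes "complex_covariance_function (\<lambda>x y. C0 (x - y))"
  shows "C0 (- t) = cnj (C0 t)"
proof -
  have "C0 (0 - t) = cnj (C0 (t - 0))"
    using assms unfolding complex_covariance_function_def hermitian_kernel_def by blast
  then show ?thesis by simp
qed

text \<open>
  Non-negative definiteness at the two points \<open>t\<close> and \<open>0\<close>, with coefficients \<open>1\<close> and \<open>- w\<close>,
  where the phase \<open>w\<close> of \<open>C0 t\<close> turns the cross terms into \<open>- 2 |C0 t|\<close>.
\<close>

lemma stationary_covariance_bound:
  fixes C0 :: "'a::ab_group_add \<Rightarrow> complex"
  assumes cov: "complex_covariance_function (\<lambda>x y. C0 (x - y))"
  shows "cmod (C0 t) \<le> Re (C0 0)"
proof -
  note herm = stationary_covariance_hermitian[OF cov]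
  define w where "w = (if C0 t = 0 then 1 else sgn (C0 t))"
  have "cmod w = 1" by (simp add: w_def norm_sgn)
  then have w1: "w * cnj w = 1" using complex_norm_square[of w] by simp
  have "C0 t = complex_of_real (cmod (C0 t)) * w"
    by (simp add: w_def sgn_div_norm scaleR_conv_of_real)
  then have w2: "cnj w * C0 t = complex_of_real (cmod (C0 t))"
    using w1 by (metis mult.commute mult.left_commute mult.right_neutral)
  define x where "x i = (if i = 0 then t else 0)" for i :: nat
  define c where "c i = (if i = 0 then 1 else - w)" for i :: nat
  have "0 \<le> (\<Sum>i<2. \<Sum>j<2. c i * cnj (c j) * C0 (x i - x j))"
    using cov unfolding complex_covariance_function_def nonneg_definite_kernel_def by blast
  also have "\<dots> = C0 0 - cnj w * C0 t - cnj (cnj w * C0 t) + w * cnj w * C0 0"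
    by (simp add: numeral_2_eq_2 x_def c_def herm)
  finally show ?thesis by (simp add: w1 w2 less_eq_complex_def)
qed

theorem proposition3p1:
  fixes C0 :: "real ^ 'd \<Rightarrow> complex"
    and C :: "real ^ 'd \<Rightarrow> real ^ 'd \<Rightarrow> complex"
    and \<phi> :: "real ^ 'd \<Rightarrow> complex"
  assumes C_eq: "\<And>x y. C x y = C0 (x - y)"
    and covariance: "complex_covariance_function C"
    and continuous: "continuous_on UNIV (\<lambda>(x, y). C x y)"
    and square_integrable: "C0 \<in> L2 lborel"
    and spectral_density: "\<phi> = fourier_L2 C0"
  shows "(\<forall>S. compact S \<longrightarrow> (\<forall>l \<in> kernel_eigenvalues C S. l \<le> 1))
           \<longleftrightarrow> (AE x in lborel. \<phi> x \<le> 1)"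
proof -
  have C: "C = (\<lambda>x y. C0 (x - y))" by (intro ext C_eq)
  have cov: "complex_covariance_function (\<lambda>x y. C0 (x - y))"
    using covariance by (simp only: C)
  note bd = stationary_covariance_bound[OF cov]
  interpret stationary_kernel C0 "Re (C0 0)"
  proof
    show "continuous_on UNIV C0"
      using continuous_on_compose2[OF continuous, of UNIV "\<lambda>x. (x, 0)"] by (simp add: C continuous_intros)
  qed (rule bd stationary_covariance_hermitian[OF cov])+
  have "has_fourier_L2 C0 \<phi>"
    unfolding spectral_density fourier_L2_def
    by (rule someI_ex[OF exists_fourier_L2[OF square_integrable bd]])
  note spectral_density_le_1_iff[OF this bd]
  moreover have "(\<forall>S. compact S \<longrightarrow> (\<forall>l \<in> kernel_eigenvalues C S. l \<le> 1)) \<longleftrightarrow>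
      (\<forall>h. test_function h \<longrightarrow> quadratic_form C0 h \<le> complex_of_real (\<integral>x. (cmod (h x))\<^sup>2 \<partial>lborel))"
    unfolding C using quadratic_form_le_of_eigenvalues eigenvalue_le_1_of_quadratic_form by blast
  ultimately show ?thesis by simp
qed

end
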